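(* Let $p>3$ be a prime. Suppose that $$p^{\frac{1}{2}}>2T_p^2W_{p-1} \log^2 p + p^{-\frac{1}{2}}.$$ Then there exists a Lehmer primitive root modulo $p$. In particular, provided $p > 7$, for the existence of a Lehmer primitive root modulo $p$ it suffices that $$p^{\frac{1}{2}}> W_{p-1}\log^2 p + p^{-\frac{1}{2}}.$$
   Context: Let $p$ be an odd prime. For an integer $a$ with $1\le a\le p-1$, $\bar a$ denotes the integer with $1\le \bar a\le p-1$ that is the inverse of $a$ modulo $p$. The integer $a$ is a Lehmer number modulo $p$ if $a$ and $\bar a$ have opposite parity, i.e. $a+\bar a$ is odd. A Lehmer primitive root (LPR) modulo $p$ is a Lehmer number modulo $p$ (so an integer in $[1,p-1]$) that is also a primitive root modulo $p$. For a positive integer $m$, $W_m=2^{\omega(m)}$ is the number of square-free divisors of $m$, where $\omega(m)$ is the number of distinct prime factors of $m$. For odd integers $m\ge 3$, $$T_m=\frac{2\sum_{j=1}^{(m-1)/2}\tan\left(\frac{\pi j}{m}\right)}{m\log m}.$$ Here $\log$ is the natural logarithm and $\log^2 p=(\log p)^2$. *)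

theory Defs
  imports "HOL-Analysis.Analysis" "HOL-Number_Theory.Number_Theory"
    "HOL-Number_Theory.Modular_Inverse"
begin

text \<open>
  The library's \<open>modular_inverse\<close> returns the representative in \<open>{0..<p}\<close> and is not
  available on \<open>nat\<close>, hence the coercions. For prime \<open>p\<close> and \<open>1 \<le> a \<le> p - 1\<close> it lies in \<open>{1..p - 1}\<close>.
\<close>

definition lehmer_number :: "nat \<Rightarrow> nat \<Rightarrow> bool" where
  "lehmer_number p a \<longleftrightarrow>
     a \<in> {1..p - 1} \<and> odd (int a + modular_inverse (int p) (int a))"

definition lehmer_primroot :: "nat \<Rightarrow> nat \<Rightarrow> bool" where
  "lehmer_primroot p a \<longleftrightarrow> lehmer_number p a \<and> residue_primroot p a"

definition num_prime_divisors :: "nat \<Rightarrow> nat" where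
  "num_prime_divisors m = card (prime_factors m)"

definition W :: "nat \<Rightarrow> nat" where
  "W m = 2 ^ num_prime_divisors m"

text \<open>Only meaningful for odd \<open>m \<ge> 3\<close>.\<close>

definition T :: "nat \<Rightarrow> real" where
  "T m = 2 * (\<Sum>j = 1..(m - 1) div 2. tan (pi * real j / real m)) / (real m * ln (real m))"

lemma lehmer_number_iff:
  assumes "prime p" "a \<in> {1..p - 1}" "b \<in> {1..p - 1}" "[a * b = 1] (mod p)"
  shows "lehmer_number p a \<longleftrightarrow> odd (a + b)"
proof -
  have "p > 1"
    using assms(1) by (rule prime_gt_1_nat)
  have "[int (a * b) = int 1] (mod int p)"
    using assms(4) by (simp only: cong_int_iff)
  hence "[int a * int b = 1] (mod int p)"
    by simp
  moreover have "int b \<in> {0..<int p}"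
    using assms(3) \<open>p > 1\<close> by auto
  ultimately have "modular_inverse (int p) (int a) = int b"
    by (intro modular_inverse_int_eqI)
  thus ?thesis
    using assms(2) unfolding lehmer_number_def by (simp flip: of_nat_add)
qed

end

theory Submission
  imports Defs "HOL-Algebra.Algebraic_Closure_Type" "Berlekamp_Zassenhaus.Finite_Field"
begin

text \<open>
  Let \<open>m = p - 1\<close> and let \<open>s(x) = (-1)^(x + x')\<close>, where \<open>x'\<close> is the inverse of \<open>x\<close> modulo \<open>p\<close>;
  so \<open>x\<close> is a Lehmer number iff \<open>s(x) = -1\<close>. If no primitive root is a Lehmer number, then the sum of
  \<open>s\<close> over the primitive roots is as large as it can be, namely \<open>\<phi>(m)\<close>. Three facts contradict this.

  The indicator of the primitive roots is a product over the primes \<open>l\<close> dividing \<open>m\<close>, and the factor of \<open>l\<close>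
  is a combination of multiplicative characters whose coefficients have absolute sum \<open>2 (1 - 1 / l)\<close>.
  Altogether this costs \<open>W(m) \<phi>(m) / m\<close> times a bound for the sums of \<open>\<eta> s\<close>, where \<open>\<eta>\<close> is a single
  character (\<open>character_sieve\<close>). The sign \<open>(-1)^x\<close> has a Fourier expansion modulo \<open>p\<close> with coefficients
  \<open>tan (\<pi> k / p) / p\<close> up to factors of modulus 1; inserted for both \<open>x\<close> and \<open>x'\<close>, it turns the sum of \<open>\<eta> s\<close>
  into an average of twisted Kloosterman sums, with total weight \<open>(T(p) log p)^2\<close>
  (\<open>sign_character_sum_bound\<close>). Finally, each twisted Kloosterman sum is at most \<open>2 sqrt p\<close>
  (\<open>kloosterman_sum_bound\<close>). So \<open>\<phi>(m) \<le> W(m) (\<phi>(m) / m) 2 sqrt p (T(p) log p)^2\<close>, against the hypothesis.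

  The last fact is Weil's bound. It is proved here without algebraic geometry. Let \<open>K(n)\<close> be the
  Kloosterman sum over the field with \<open>p^n\<close> elements, with characters pulled back along norm and trace.
  An element of a quadratic extension is determined up to conjugation by its norm and trace, and comparing
  such elements with pairs from the base field gives \<open>K(2 n) = - K(n)^2 + 2 p^n \<epsilon>\<close> with
  \<open>\<bar>\<epsilon>\<bar> = 1\<close> (\<open>kloosterman_quadratic_extension\<close>). Hence \<open>t = \<bar>K(n)\<bar> / (2 p^(n/2))\<close> grows at least like
  \<open>2 t^2 - 1\<close> under doubling of \<open>n\<close>, and \<open>t > 1\<close> for \<open>n = 1\<close> would make it unbounded along the powers of 2.
  But any bound \<open>\<bar>K(2 n)\<bar> \<le> C p^n\<close> with \<open>C\<close> independent of \<open>n\<close> excludes this, and such a crude bound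
  follows from Stepanov's method: the elements with prescribed norm \<open>z\<close> and prescribed trace of
  \<open>a x + b / x\<close> are roots of a nonzero polynomial whose degree is hardly larger than their expected number
  (\<open>stepanov_bound\<close>).

  The second assertion of the theorem follows from the first because \<open>T(p) \<le> 1 / sqrt 2\<close> as soon as
  \<open>log p \<ge> 10\<close>, and its hypothesis forces \<open>p\<close> to be that large since \<open>W(p - 1) \<ge> 2\<close>.
\<close>

hide_const (open) up_ring.monom up_ring.coeff Coset.order module.smult Divisibility.prime
  Polynomials.degree Polynomials.lead_coeff

section \<open>Finite subfields of an algebraically closed field\<close>

text \<open>
  All finite fields of characteristic \<open>p\<close> are realised inside one algebraically closed type, as the fixed
  points of powers of the Frobenius map. This makes a tower of extensions a chain of sets.
\<close>

definition GF :: "nat \<Rightarrow> 'a :: semiring_1 set" where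
  "GF m = {x. x ^ (CHAR('a) ^ m) = x}"

lemma frob_add: "(x + y :: 'a :: field_prime_char) ^ (CHAR('a) ^ m) = x ^ (CHAR('a) ^ m) + y ^ (CHAR('a) ^ m)"
  by (rule freshmans_dream') auto

lemma frob_sum: "(\<Sum>i\<in>A. f i :: 'a :: field_prime_char) ^ (CHAR('a) ^ m) = (\<Sum>i\<in>A. f i ^ (CHAR('a) ^ m))"
  by (rule freshmans_dream_sum') auto

lemma frob_diff: "(x - y :: 'a :: field_prime_char) ^ (CHAR('a) ^ m) = x ^ (CHAR('a) ^ m) - y ^ (CHAR('a) ^ m)"
  using frob_add[of "x - y" y m] by (simp add: algebra_simps)

lemma frob_uminus: "(- x :: 'a :: field_prime_char) ^ (CHAR('a) ^ m) = - (x ^ (CHAR('a) ^ m))"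
  using frob_diff[of 0 x m] by simp

lemma GF_0 [simp]: "(0 :: 'a :: field_prime_char) \<in> GF m"
  by (simp add: GF_def)

lemma GF_1 [simp]: "1 \<in> GF m"
  by (simp add: GF_def)

lemma GF_add: "x \<in> GF m \<Longrightarrow> y \<in> GF m \<Longrightarrow> (x + y :: 'a :: field_prime_char) \<in> GF m"
  by (simp add: GF_def frob_add)

lemma GF_diff: "x \<in> GF m \<Longrightarrow> y \<in> GF m \<Longrightarrow> (x - y :: 'a :: field_prime_char) \<in> GF m"
  by (simp add: GF_def frob_diff)

lemma GF_uminus: "x \<in> GF m \<Longrightarrow> (- x :: 'a :: field_prime_char) \<in> GF m"
  by (simp add: GF_def frob_uminus)

lemma GF_mult: "x \<in> GF m \<Longrightarrow> y \<in> GF m \<Longrightarrow> (x * y :: 'a :: field_prime_char) \<in> GF m"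
  by (simp add: GF_def power_mult_distrib)

lemma GF_divide: "x \<in> GF m \<Longrightarrow> y \<in> GF m \<Longrightarrow> (x / y :: 'a :: field_prime_char) \<in> GF m"
  by (simp add: GF_def power_divide)

lemma GF_power: "x \<in> GF m \<Longrightarrow> (x ^ n :: 'a :: field_prime_char) \<in> GF m"
  by (induction n) (auto intro: GF_mult)

lemma GF_sum: "(\<And>i. i \<in> A \<Longrightarrow> f i \<in> GF m) \<Longrightarrow> (\<Sum>i\<in>A. f i :: 'a :: field_prime_char) \<in> GF m"
  by (simp add: GF_def frob_sum)

lemma GF_mono:
  assumes "m dvd n" "x \<in> GF m"
  shows "(x :: 'a :: field_prime_char) \<in> GF n"
proof -
  obtain k where n: "n = m * k"
    using assms(1) by blast
  have "x ^ (CHAR('a) ^ (m * k)) = x"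
    using assms(2) by (induction k) (simp_all add: GF_def power_add power_mult)
  then show ?thesis
    by (simp add: GF_def n)
qed

lemma GF_prime: "x \<in> GF 1 \<Longrightarrow> (x :: 'a :: field_prime_char) \<in> GF m"
  by (rule GF_mono[of 1]) auto

text \<open>
  The polynomial \<open>X^q - X\<close> has derivative \<open>-1\<close>, so its \<open>q\<close> roots in an algebraically closed field are
  distinct.
\<close>

lemma finite_card_GF:
  assumes "m > 0"
  shows "finite (GF m :: 'a :: {alg_closed_field, field_prime_char} set)"
    and "card (GF m :: 'a set) = CHAR('a) ^ m"
proof -
  define q where "q = CHAR('a) ^ m"
  have "CHAR('a) > 1"
    using prime_gt_1_nat CHAR_prime by blast
  then have q: "q > 1"
    unfolding q_def using assms by (rule one_less_power)
  define P :: "'a poly" where "P = monom 1 q - monom 1 1"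
  have deg: "degree P = q"
    unfolding P_def diff_conv_add_uminus using q by (subst degree_add_eq_left) (auto simp: degree_monom_eq)
  then have P0: "P \<noteq> 0"
    using q by auto
  have roots: "{x. poly P x = 0} = GF m"
    by (auto simp: P_def poly_monom GF_def q_def)
  have "of_nat q = (0 :: 'a)"
    unfolding q_def using assms by (simp add: power_0_left)
  then have "pderiv P = - 1"
    unfolding P_def by (simp add: pderiv_diff pderiv_monom monom_0 one_pCons)
  then have "order x P \<le> 1" for x
  proof -
    have "order x P = 0 \<or> order x P = 1"
    proof (rule ccontr)
      assume *: "\<not> ?thesis"
      have "[:- x, 1:] ^ 2 dvd P"
        using * by (intro power_le_dvd[OF order_1]) auto
      then obtain Q where "P = [:- x, 1:] ^ 2 * Q"
        by (elim dvdE)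
      then have "P = [:- x, 1:] * ([:- x, 1:] * Q)"
        by (simp only: power2_eq_square mult.assoc)
      then have "pderiv P = [:- x, 1:] * Q + [:- x, 1:] * pderiv ([:- x, 1:] * Q)"
        by (simp only: pderiv_mult) (simp add: pderiv_pCons)
      then have "poly (pderiv P) x = 0"
        by simp
      with \<open>pderiv P = - 1\<close> show False
        by simp
    qed
    then show ?thesis by auto
  qed
  then have "proots P = mset_set (set_mset (proots P))"
    by (intro multiset_eqI) (simp add: count_mset_set' P0 le_Suc_eq order_eq_0_iff poly_roots_finite)
  then have "size (proots P) = card (set_mset (proots P))"
    by (metis size_mset_set)
  moreover have "size (proots P) = degree P"
  proof -
    obtain A where A: "size A = degree P" "P = smult (lead_coeff P) (\<Prod>x\<in>#A. [:-x, 1:])"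
      using alg_closed_imp_factorization[OF P0] by blast
    have "proots P = proots (\<Prod>x\<in>#A. [:-x, 1:])"
      using P0 by (subst A(2)) (subst proots_smult, auto)
    also have "\<dots> = A"
    proof (induction A)
      case (add x A)
      have "(\<Prod>x\<in>#A. [:-x, 1:]) \<noteq> (0 :: 'a poly)"
        by (auto simp: prod_mset_zero_iff)
      then show ?case
        using add by (simp add: proots_mult del: mult_pCons_left)
    qed simp
    finally show ?thesis
      using A(1) by simp
  qed
  moreover have "set_mset (proots P) = {x. poly P x = 0}"
    using P0 by simp
  ultimately show "finite (GF m :: 'a set)" "card (GF m :: 'a set) = CHAR('a) ^ m"
    using deg roots q_def poly_roots_finite[OF P0] by simp_all
qed

section \<open>Norm and trace\<close>

text \<open>
  The norm and the trace from the field with \<open>p^m\<close> elements to the prime field: the product and the sum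
  of the conjugates \<open>x^(p^i)\<close> with \<open>i < m\<close>.
\<close>

definition fnorm :: "nat \<Rightarrow> 'a \<Rightarrow> 'a :: field_prime_char" where
  "fnorm m x = x ^ (\<Sum>i<m. CHAR('a) ^ i)"

definition ftrace :: "nat \<Rightarrow> 'a \<Rightarrow> 'a :: field_prime_char" where
  "ftrace m x = (\<Sum>i<m. x ^ (CHAR('a) ^ i))"

lemma fnorm_mult: "fnorm m (x * y) = fnorm m x * fnorm m y"
  by (simp add: fnorm_def power_mult_distrib)

lemma fnorm_eq_0_iff: "m > 0 \<Longrightarrow> fnorm m x = 0 \<longleftrightarrow> x = 0"
  by (auto simp: fnorm_def intro!: sum_pos)

lemma ftrace_add: "ftrace m (x + y) = ftrace m x + ftrace m y"
  by (simp add: ftrace_def frob_add sum.distrib)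

lemma fnorm_1 [simp]: "fnorm (Suc 0) x = x"
  by (simp add: fnorm_def)

lemma ftrace_1 [simp]: "ftrace (Suc 0) x = x"
  by (simp add: ftrace_def)

lemma GF_frob: "x \<in> GF m \<Longrightarrow> (x :: 'a :: field_prime_char) ^ (CHAR('a) ^ m) = x"
  by (simp add: GF_def)

lemma fnorm_in_prime_field:
  assumes "x \<in> GF m"
  shows "fnorm m x \<in> GF 1"
proof (cases "x = 0")
  case False
  have "fnorm m x ^ CHAR('a) * x = x ^ (CHAR('a) * (\<Sum>i<m. CHAR('a) ^ i) + 1)"
    by (simp add: fnorm_def power_mult [symmetric] mult.commute)
  also have "CHAR('a) * (\<Sum>i<m. CHAR('a) ^ i) + 1 = (\<Sum>i<m. CHAR('a) ^ i) + CHAR('a) ^ m"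
    by (induction m) (simp_all add: algebra_simps)
  also have "x ^ \<dots> = fnorm m x * x"
    using assms by (simp add: fnorm_def power_add GF_frob)
  finally show ?thesis
    using False by (simp add: GF_def)
qed (simp add: fnorm_def GF_power)

lemma ftrace_in_prime_field:
  assumes "x \<in> GF m"
  shows "ftrace m x \<in> GF 1"
proof -
  have "ftrace m x ^ CHAR('a) = (\<Sum>i<m. x ^ (CHAR('a) ^ Suc i))"
    using frob_sum[of "\<lambda>i. x ^ (CHAR('a) ^ i)" "{..<m}" 1]
    by (simp add: ftrace_def power_mult [symmetric] mult.commute)
  also have "\<dots> = ftrace m x + x ^ (CHAR('a) ^ m) - x"
    unfolding ftrace_def by (induction m) simp_all
  finally show ?thesis
    using assms by (simp add: GF_def)
qed

lemma fnorm_double: "fnorm (2 * m) x = fnorm m (x * x ^ (CHAR('a) ^ m) :: 'a :: field_prime_char)"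
proof -
  have "(\<Sum>i<2 * m. CHAR('a) ^ i) = (\<Sum>i<m. CHAR('a) ^ i) + CHAR('a) ^ m * (\<Sum>i<m. CHAR('a) ^ i)"
    unfolding mult_2 lessThan_atLeast0
    by (subst sum.atLeastLessThan_concat [of 0 m "m + m", symmetric])
       (simp_all add: sum.atLeastLessThan_shift_0 [of _ m] sum_distrib_left power_add)
  then show ?thesis
    by (simp add: fnorm_def power_add power_mult power_mult_distrib)
qed

lemma ftrace_double: "ftrace (2 * m) x = ftrace m (x + x ^ (CHAR('a) ^ m) :: 'a :: field_prime_char)"
proof -
  have "(\<Sum>i<2 * m. x ^ (CHAR('a) ^ i)) = (\<Sum>i<m. x ^ (CHAR('a) ^ i)) + (\<Sum>i<m. x ^ (CHAR('a) ^ m * CHAR('a) ^ i))"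
    unfolding mult_2 lessThan_atLeast0
    by (subst sum.atLeastLessThan_concat [of 0 m "m + m", symmetric])
       (simp_all add: sum.atLeastLessThan_shift_0 [of _ m] power_add)
  then show ?thesis
    by (simp add: ftrace_def frob_add sum.distrib power_mult)
qed

text \<open>
  The trace is a polynomial function of degree \<open>p^(m - 1)\<close>, too small to vanish on \<open>p^m\<close> elements.
\<close>

lemma ftrace_nonzero_exists:
  assumes "m > 0"
  shows "\<exists>x \<in> GF m. ftrace m x \<noteq> (0 :: 'a :: {alg_closed_field, field_prime_char})"
proof (rule ccontr)
  assume neg: "\<not> ?thesis"
  define P :: "'a poly" where "P = (\<Sum>i<m. monom 1 (CHAR('a) ^ i))"
  have p: "CHAR('a) > 1"
    using prime_gt_1_nat CHAR_prime by blast
  have "degree (monom (1 :: 'a) (CHAR('a) ^ i)) \<le> CHAR('a) ^ (m - 1)" if "i < m" for i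
    using that p by (simp add: degree_monom_eq power_increasing)
  then have "degree P \<le> CHAR('a) ^ (m - 1)"
    unfolding P_def by (intro degree_sum_le) auto
  moreover have "CHAR('a) ^ (m - 1) < CHAR('a) ^ m"
    using p assms by (intro power_strict_increasing) auto
  ultimately have deg: "degree P < CHAR('a) ^ m"
    by simp
  have "coeff P 1 = (\<Sum>i<m. if i = 0 then 1 else 0)"
    unfolding P_def coeff_sum using p by (intro sum.cong) auto
  also have "\<dots> = 1"
    using assms by simp
  finally have "P \<noteq> 0"
    by auto
  moreover have "GF m \<subseteq> {x. poly P x = 0}"
    using neg by (auto simp: P_def ftrace_def poly_sum poly_monom)
  ultimately have "card (GF m :: 'a set) \<le> degree P"
    using order_trans[OF card_mono[OF poly_roots_finite] card_poly_roots_bound] by blast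
  with deg show False
    using assms by (simp add: finite_card_GF)
qed

text \<open>
  An element of the quadratic extension with trace \<open>s\<close> and norm \<open>c\<close> is a root of \<open>X^2 - s X + c\<close>, and so are
  the members of a pair from the base field with sum \<open>s\<close> and product \<open>c\<close>. Frobenius permutes the two
  roots \<open>u\<close> and \<open>v\<close>. If it swaps distinct roots, both belong to the first kind and there are no pairs; if it fixes
  distinct roots, there are two ordered pairs and nothing of the first kind; a double root contributes
  one of each. The total is always 2.
\<close>

lemma quadratic_fibre_count:
  fixes s c :: "'a :: {alg_closed_field, field_prime_char}"
  assumes m: "m > 0" and s: "s \<in> GF m" and c: "c \<in> GF m"
  defines "q \<equiv> CHAR('a) ^ m"
  shows "card {x \<in> GF (2 * m). x + x ^ q = s \<and> x * x ^ q = c} +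
         card {(u, v) \<in> GF m \<times> GF m. u + v = s \<and> u * v = c} = 2"
proof -
  obtain u where u: "u * u - s * u + c = 0"
    using alg_closed_imp_poly_has_root[of "[:c, - s, 1:]"] by (auto simp: algebra_simps)
  define v where "v = s - u"
  have sv: "s = u + v" and cv: "c = u * v"
    using u by (simp_all add: v_def algebra_simps)
  have roots: "x = u \<or> x = v" if "x * x - s * x + c = 0" for x
  proof -
    have "(x - u) * (x - v) = 0"
      using that by (simp add: sv cv algebra_simps)
    then show ?thesis by auto
  qed
  have frob_root: "x ^ q * x ^ q - s * x ^ q + c = 0" if "x * x - s * x + c = 0" for x
  proof -
    have "x ^ q * x ^ q - s * x ^ q + c = (x * x - s * x + c) ^ q"
      using s c by (simp add: q_def frob_add frob_diff power_mult_distrib GF_frob)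
    then show ?thesis
      by (simp add: that q_def)
  qed
  have ruv: "u * u - s * u + c = 0" "v * v - s * v + c = 0"
    by (simp_all add: sv cv algebra_simps)
  have q2: "CHAR('a) ^ (2 * m) = q * q"
    by (simp add: q_def power_add mult_2)
  have GF2: "x \<in> GF (2 * m) \<longleftrightarrow> (x ^ q) ^ q = x" for x :: 'a
    unfolding GF_def mem_Collect_eq q2 power_mult[symmetric] ..
  have GF1: "x \<in> GF m \<longleftrightarrow> x ^ q = x" for x :: 'a
    by (simp add: GF_def q_def)
  have A: "{x \<in> GF (2 * m). x + x ^ q = s \<and> x * x ^ q = c} =
           {x \<in> {u, v}. (x ^ q) ^ q = x \<and> x + x ^ q = s \<and> x * x ^ q = c}"
  proof -
    have "x = u \<or> x = v" if "x + x ^ q = s" "x * x ^ q = c" for x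
      by (rule roots) (simp add: algebra_simps flip: that)
    then show ?thesis
      by (auto simp: GF2)
  qed
  have B: "{(x, y) \<in> GF m \<times> GF m. x + y = s \<and> x * y = c} =
           {(x, y). (x, y) \<in> {(u, v), (v, u)} \<and> x ^ q = x \<and> y ^ q = y}"
  proof -
    have "(x = u \<and> y = v) \<or> (x = v \<and> y = u)" if "x + y = s" "x * y = c" for x y
    proof -
      have "x = u \<or> x = v"
        by (rule roots) (simp add: algebra_simps flip: that)
      moreover have "y = s - x"
        by (simp flip: that)
      ultimately show ?thesis
        by (auto simp: sv)
    qed
    then show ?thesis
      by (auto simp: GF1 sv cv mult.commute add.commute)
  qed
  have uq: "u ^ q = u \<or> u ^ q = v" and vq: "v ^ q = u \<or> v ^ q = v"
    using roots[OF frob_root] ruv by auto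
  have sq: "u ^ q + v ^ q = u + v"
    using s frob_add[of u v m] by (simp add: GF1 sv q_def)
  consider "u = v" | "u \<noteq> v" "u ^ q = u" "v ^ q = v" | "u \<noteq> v" "u ^ q = v" "v ^ q = u"
    using uq vq sq by fastforce
  then show ?thesis
  proof cases
    case 1
    then have "u ^ q = u"
      using uq by auto
    from 1 and this have sets: "{x \<in> GF (2 * m). x + x ^ q = s \<and> x * x ^ q = c} = {u}"
      "{(x, y) \<in> GF m \<times> GF m. x + y = s \<and> x * y = c} = {(u, u)}"
      unfolding A B by (auto simp: sv cv)
    show ?thesis
      unfolding sets by simp
  next
    case 2
    have sets: "{x \<in> GF (2 * m). x + x ^ q = s \<and> x * x ^ q = c} = {}"
      "{(x, y) \<in> GF m \<times> GF m. x + y = s \<and> x * y = c} = {(u, v), (v, u)}"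
      unfolding A B using 2 by (auto simp: sv cv)
    show ?thesis
      unfolding sets using 2 by simp
  next
    case 3
    have sets: "{x \<in> GF (2 * m). x + x ^ q = s \<and> x * x ^ q = c} = {u, v}"
      "{(x, y) \<in> GF m \<times> GF m. x + y = s \<and> x * y = c} = {}"
      unfolding A B using 3 by (auto simp: sv cv mult.commute add.commute)
    show ?thesis
      unfolding sets using 3 by simp
  qed
qed

lemma ftrace_scale:
  assumes "c \<in> GF 1"
  shows "ftrace m (c * x) = c * ftrace m (x :: 'a :: field_prime_char)"
proof -
  have "c ^ (CHAR('a) ^ i) = c" for i
    using GF_prime[OF assms, of i] by (simp add: GF_def)
  then show ?thesis
    by (simp add: ftrace_def power_mult_distrib sum_distrib_left)
qed

section \<open>Twisted Kloosterman sums and quadratic extensions\<close>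

locale finite_field_characters =
  fixes \<eta> \<psi> :: "'a :: {alg_closed_field, field_prime_char} \<Rightarrow> complex"
  assumes eta_mult: "x \<in> GF 1 - {0} \<Longrightarrow> y \<in> GF 1 - {0} \<Longrightarrow> \<eta> (x * y) = \<eta> x * \<eta> y"
    and norm_eta: "x \<in> GF 1 - {0} \<Longrightarrow> norm (\<eta> x) = 1"
    and psi_add: "x \<in> GF 1 \<Longrightarrow> y \<in> GF 1 \<Longrightarrow> \<psi> (x + y) = \<psi> x * \<psi> y"
    and norm_psi: "x \<in> GF 1 \<Longrightarrow> norm (\<psi> x) = 1"
    and psi_nontrivial: "\<exists>x \<in> GF 1. \<psi> x \<noteq> 1"
begin

lemma fnorm_nonzero: "m > 0 \<Longrightarrow> x \<in> GF m - {0} \<Longrightarrow> fnorm m x \<in> GF 1 - {0 :: 'a}"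
  using fnorm_in_prime_field[of x m] by (auto simp: fnorm_eq_0_iff)

lemma psi_ftrace_add:
  "x \<in> GF m \<Longrightarrow> y \<in> GF m \<Longrightarrow> \<psi> (ftrace m (x + y)) = \<psi> (ftrace m x) * \<psi> (ftrace m y)"
  by (simp only: ftrace_add psi_add ftrace_in_prime_field)

lemma eta_fnorm_mult:
  "m > 0 \<Longrightarrow> x \<in> GF m - {0} \<Longrightarrow> y \<in> GF m - {0} \<Longrightarrow>
     \<eta> (fnorm m (x * y)) = \<eta> (fnorm m x) * \<eta> (fnorm m y)"
  by (simp only: fnorm_mult eta_mult fnorm_nonzero)

text \<open>
  Orthogonality: a shift by some \<open>u\<close> with \<open>\<psi> (ftrace m (u * w)) \<noteq> 1\<close> multiplies the sum by this value.
\<close>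

lemma sum_additive_character:
  assumes m: "m > 0" and w: "w \<in> GF m"
  shows "(\<Sum>s\<in>GF m. \<psi> (ftrace m (s * w))) = (if w = 0 then of_nat (CHAR('a) ^ m) else 0)"
proof (cases "w = 0")
  case True
  have "\<psi> 0 * \<psi> 0 = \<psi> 0" "norm (\<psi> 0) = 1"
    using psi_add[of 0 0] norm_psi[of 0] by auto
  then have "\<psi> 0 = 1"
    by auto
  then show ?thesis
    using True finite_card_GF[OF m, where ?'a = 'a] by (simp add: ftrace_def power_0_left)
next
  case False
  obtain x y where xy: "x \<in> GF m" "y = ftrace m x" "y \<noteq> (0 :: 'a)"
    using ftrace_nonzero_exists[OF m, where ?'a = 'a] by auto
  obtain z where z: "z \<in> GF 1" "\<psi> z \<noteq> 1"
    using psi_nontrivial by auto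
  have y: "y \<in> GF 1"
    using xy ftrace_in_prime_field by blast
  define u where "u = z / y * x / w"
  have u: "u \<in> GF m"
    unfolding u_def using xy w GF_prime[OF y, of m] GF_prime[OF z(1), of m]
    by (intro GF_divide GF_mult)
  have "ftrace m (u * w) = z"
    using False xy ftrace_scale[OF GF_divide[OF z(1) y], of m x] by (simp add: u_def)
  have bij: "bij_betw (\<lambda>s. s + u) (GF m) (GF m)"
    by (rule bij_betwI[where g = "\<lambda>s. s - u"]) (auto intro: GF_add GF_diff u)
  have "(\<Sum>s\<in>GF m. \<psi> (ftrace m (s * w))) = (\<Sum>s\<in>GF m. \<psi> (ftrace m ((s + u) * w)))"
    using sum.reindex_bij_betw[OF bij, of "\<lambda>s. \<psi> (ftrace m (s * w))"] by simp
  also have "\<dots> = (\<Sum>s\<in>GF m. \<psi> (ftrace m (s * w)) * \<psi> z)"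
    using \<open>ftrace m (u * w) = z\<close> u w
    by (intro sum.cong refl) (simp only: distrib_right psi_ftrace_add GF_mult)
  also have "\<dots> = (\<Sum>s\<in>GF m. \<psi> (ftrace m (s * w))) * \<psi> z"
    by (simp add: sum_distrib_right)
  finally show ?thesis
    using z False by auto
qed

definition kloosterman :: "nat \<Rightarrow> 'a \<Rightarrow> 'a \<Rightarrow> complex" where
  "kloosterman m a b = (\<Sum>x\<in>GF m - {0}. \<eta> (fnorm m x) * \<psi> (ftrace m (a * x + b / x)))"

text \<open>
  Both sums on the left are sums of the same function \<open>h\<close> of two elements of the base field: of trace and
  norm of \<open>x\<close> in the first, of sum and product of a pair in the second, since
  \<open>a x + b / x + a y + b / y = (x + y) (a + b / (x y))\<close>. By \<open>quadratic_fibre_count\<close> together they count every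
  argument \<open>(s, c)\<close> of \<open>h\<close> twice. The sum over \<open>s\<close> is then an additive character sum, which
  vanishes unless \<open>a + b / c = 0\<close>.
\<close>

lemma kloosterman_quadratic_extension:
  assumes m: "m > 0" and a: "a \<in> GF 1 - {0}" and b: "b \<in> GF 1 - {0}"
  shows "kloosterman (2 * m) a b + kloosterman m a b ^ 2 =
         2 * of_nat (CHAR('a) ^ m) * \<eta> (fnorm m (- b / a))"
proof -
  define q where "q = CHAR('a) ^ m"
  define h where "h = (\<lambda>(s, c). \<eta> (fnorm m c) * \<psi> (ftrace m (s * (a + b / c))))"
  define T :: "('a \<times> 'a) set" where "T = GF m \<times> (GF m - {0})"
  have aq: "a ^ q = a" "b ^ q = b" and am: "a \<in> GF m" "b \<in> GF m"
    using a b GF_prime[of a m] GF_prime[of b m] by (auto simp: GF_def q_def)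
  have fin: "finite (GF m :: 'a set)" "finite (GF (2 * m) :: 'a set)"
    using m by (auto simp: finite_card_GF)
  have [simp]: "finite T"
    using fin by (simp add: T_def)
  have GF_q2: "x ^ q \<in> GF (2 * m)" "x + x ^ q \<in> GF m" "x * x ^ q \<in> GF m"
    if x: "x \<in> GF (2 * m)" for x :: 'a
  proof -
    have "CHAR('a) ^ (2 * m) = q * q"
      by (simp add: q_def power_add mult_2)
    then have xqq: "(x ^ q) ^ q = x"
      using x unfolding GF_def mem_Collect_eq power_mult[symmetric] by simp
    show "x ^ q \<in> GF (2 * m)"
      using x by (rule GF_power)
    show "x + x ^ q \<in> GF m"
      using xqq frob_add[of x "x ^ q" m] by (simp add: GF_def q_def[symmetric] add.commute)
    show "x * x ^ q \<in> GF m"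
      using xqq by (simp add: GF_def q_def[symmetric] power_mult_distrib mult.commute)
  qed
  have quad: "a * x + b / x + (a * y + b / y) = (x + y) * (a + b / (x * y))"
    if "x \<noteq> 0" "y \<noteq> 0" for x y
    using that by (simp add: field_simps)
  have K2: "kloosterman (2 * m) a b = (\<Sum>x\<in>GF (2 * m) - {0}. h (x + x ^ q, x * x ^ q))"
    unfolding kloosterman_def
  proof (intro sum.cong refl)
    fix x :: 'a assume x: "x \<in> GF (2 * m) - {0}"
    have "(a * x + b / x) ^ q = a * x ^ q + b / x ^ q"
      using aq by (simp add: q_def frob_add power_mult_distrib power_divide)
    then have "ftrace (2 * m) (a * x + b / x) = ftrace m ((x + x ^ q) * (a + b / (x * x ^ q)))"
      using quad[of x "x ^ q"] x by (simp add: ftrace_double flip: q_def)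
    then show "\<eta> (fnorm (2 * m) x) * \<psi> (ftrace (2 * m) (a * x + b / x)) =
               h (x + x ^ q, x * x ^ q)"
      by (simp add: h_def fnorm_double flip: q_def)
  qed
  have K1: "kloosterman m a b ^ 2 = (\<Sum>(u, v)\<in>(GF m - {0}) \<times> (GF m - {0}). h (u + v, u * v))"
    unfolding power2_eq_square kloosterman_def sum_product sum.cartesian_product
  proof (intro sum.cong refl)
    fix z :: "'a \<times> 'a" assume z: "z \<in> (GF m - {0}) \<times> (GF m - {0})"
    define u v where "u = fst z" and "v = snd z"
    then have zuv: "z = (u, v)" and uv: "u \<in> GF m" "u \<noteq> 0" "v \<in> GF m" "v \<noteq> 0"
      using z by auto
    have "\<eta> (fnorm m (u * v)) = \<eta> (fnorm m u) * \<eta> (fnorm m v)"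
      using uv m by (intro eta_fnorm_mult) auto
    moreover have "\<psi> (ftrace m ((u + v) * (a + b / (u * v)))) =
        \<psi> (ftrace m (a * u + b / u)) * \<psi> (ftrace m (a * v + b / v))"
      using uv am by (subst quad [symmetric])
        (auto intro!: psi_ftrace_add GF_add GF_mult GF_divide)
    ultimately show "(case z of (u, v) \<Rightarrow> \<eta> (fnorm m u) * \<psi> (ftrace m (a * u + b / u)) *
       (\<eta> (fnorm m v) * \<psi> (ftrace m (a * v + b / v)))) = (case z of (u, v) \<Rightarrow> h (u + v, u * v))"
      by (simp add: h_def zuv)
  qed
  have G2: "(\<Sum>x\<in>GF (2 * m) - {0}. h (x + x ^ q, x * x ^ q)) =
    (\<Sum>y\<in>T. h y * of_nat (card {x \<in> GF (2 * m) - {0}. (x + x ^ q, x * x ^ q) = y}))"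
  proof -
    have "(\<Sum>x\<in>GF (2 * m) - {0}. h (x + x ^ q, x * x ^ q)) = (\<Sum>y\<in>T. \<Sum>x \<in> {x \<in> GF (2 * m) - {0}.
             (x + x ^ q, x * x ^ q) = y}. h (x + x ^ q, x * x ^ q))"
      by (rule sum.group [symmetric]) (use fin GF_q2 in \<open>auto simp: T_def\<close>)
    also have "\<dots> = (\<Sum>y\<in>T. \<Sum>x \<in> {x \<in> GF (2 * m) - {0}. (x + x ^ q, x * x ^ q) = y}. h y)"
      by (intro sum.cong refl) auto
    finally show ?thesis
      by (simp add: mult.commute)
  qed
  have pairs: "{z \<in> (GF m - {0}) \<times> (GF m - {0}). (fst z + snd z, fst z * snd z) = y} =
      {(u, v) \<in> (GF m - {0}) \<times> (GF m - {0}). (u + v, u * v) = y}" for y :: "'a \<times> 'a"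
    by auto
  have G1: "(\<Sum>(u, v)\<in>(GF m - {0}) \<times> (GF m - {0}). h (u + v, u * v)) =
    (\<Sum>y\<in>T. h y * of_nat (card {(u, v) \<in> (GF m - {0}) \<times> (GF m - {0}). (u + v, u * v) = y}))"
  proof -
    have "(\<Sum>(u, v)\<in>(GF m - {0}) \<times> (GF m - {0}). h (u + v, u * v)) =
      (\<Sum>z\<in>(GF m - {0}) \<times> (GF m - {0}). h (fst z + snd z, fst z * snd z))"
      by (simp add: case_prod_beta)
    also have "\<dots> = (\<Sum>y\<in>T. \<Sum>z \<in> {z \<in> (GF m - {0}) \<times> (GF m - {0}).
             (fst z + snd z, fst z * snd z) = y}. h (fst z + snd z, fst z * snd z))"
      by (rule sum.group [symmetric]) (use fin in \<open>auto simp: T_def GF_add GF_mult\<close>)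
    also have "\<dots> = (\<Sum>y\<in>T. \<Sum>z \<in> {z \<in> (GF m - {0}) \<times> (GF m - {0}).
             (fst z + snd z, fst z * snd z) = y}. h y)"
      by (intro sum.cong refl) auto
    finally show ?thesis
      unfolding pairs by (simp add: mult.commute)
  qed
  have count: "card {x \<in> GF (2 * m) - {0}. (x + x ^ q, x * x ^ q) = y} +
     card {(u, v) \<in> (GF m - {0}) \<times> (GF m - {0}). (u + v, u * v) = y} = 2" if yT: "y \<in> T" for y
  proof -
    obtain s c where y: "y = (s, c)" and sc: "s \<in> GF m" "c \<in> GF m" "c \<noteq> 0"
      using yT by (auto simp: T_def)
    have "{x \<in> GF (2 * m) - {0}. (x + x ^ q, x * x ^ q) = y} =
          {x \<in> GF (2 * m). x + x ^ q = s \<and> x * x ^ q = c}"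
      "{(u, v). (u, v) \<in> (GF m - {0}) \<times> (GF m - {0}) \<and> (u + v, u * v) = y} =
       {(u, v). (u, v) \<in> GF m \<times> GF m \<and> u + v = s \<and> u * v = c}"
      using sc y by auto
    then show ?thesis
      using quadratic_fibre_count[OF m sc(1,2)] by (simp only: q_def)
  qed
  have "kloosterman (2 * m) a b + kloosterman m a b ^ 2 =
    (\<Sum>y\<in>T. h y * of_nat (card {x \<in> GF (2 * m) - {0}. (x + x ^ q, x * x ^ q) = y} +
         card {(u, v) \<in> (GF m - {0}) \<times> (GF m - {0}). (u + v, u * v) = y}))"
    unfolding K2 K1 G2 G1 by (simp only: of_nat_add distrib_left sum.distrib)
  also have "\<dots> = (\<Sum>y\<in>T. h y * 2)"
    by (intro sum.cong refl) (simp only: count of_nat_numeral)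
  also have "\<dots> = 2 * (\<Sum>c\<in>GF m - {0}. \<Sum>s\<in>GF m. h (s, c))"
    unfolding T_def by (subst sum.swap) (simp add: sum.cartesian_product sum_distrib_left mult.commute)
  also have "(\<Sum>c\<in>GF m - {0}. \<Sum>s\<in>GF m. h (s, c)) =
             (\<Sum>c\<in>GF m - {0}. if c = - b / a then of_nat q * \<eta> (fnorm m c) else 0)"
  proof (intro sum.cong refl)
    fix c :: 'a assume c: "c \<in> GF m - {0}"
    have "(\<Sum>s\<in>GF m. h (s, c)) = \<eta> (fnorm m c) * (\<Sum>s\<in>GF m. \<psi> (ftrace m (s * (a + b / c))))"
      by (simp add: h_def sum_distrib_left)
    also have "\<dots> = \<eta> (fnorm m c) * (if a + b / c = 0 then of_nat q else 0)"
      using c am by (subst sum_additive_character) (auto simp: m q_def intro!: GF_add GF_divide)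
    also have "a + b / c = 0 \<longleftrightarrow> c = - b / a"
      using a c by (auto simp: field_simps add_eq_0_iff2)
    finally show "(\<Sum>s\<in>GF m. h (s, c)) = (if c = - b / a then of_nat q * \<eta> (fnorm m c) else 0)"
      by (simp add: mult.commute)
  qed
  also have "\<dots> = of_nat q * \<eta> (fnorm m (- b / a))"
    using fin am a b by (simp add: sum.delta GF_divide GF_uminus)
  finally show ?thesis
    by (simp add: q_def)
qed

end

section \<open>Linear dependence among polynomials\<close>

lemma distinct_degrees_independent:
  fixes M :: "'i \<Rightarrow> 'a :: idom poly"
  assumes fin: "finite A" and inj: "inj_on (\<lambda>i. degree (M i)) A" and M: "\<And>i. i \<in> A \<Longrightarrow> M i \<noteq> 0"
    and sum: "(\<Sum>i\<in>A. smult (c i) (M i)) = 0" and i: "i \<in> A"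
  shows "c i = 0"
proof (rule ccontr)
  define B where "B = {i \<in> A. c i \<noteq> 0}"
  assume "c i \<noteq> 0"
  then have B: "finite B" "B \<noteq> {}" "B \<subseteq> A"
    using fin i by (auto simp: B_def)
  define d where "d = Max ((\<lambda>i. degree (M i)) ` B)"
  have "d \<in> (\<lambda>i. degree (M i)) ` B"
    unfolding d_def using B by (intro Max_in) auto
  then obtain k where k: "k \<in> B" "degree (M k) = d"
    by auto
  have small: "coeff (smult (c j) (M j)) d = 0" if "j \<in> A - {k}" for j
  proof (cases "c j = 0")
    case False
    then have "j \<in> B" "j \<noteq> k"
      using that by (auto simp: B_def)
    then have "degree (M j) \<le> d"
      using B unfolding d_def by (intro Max_ge) auto
    moreover have "degree (M j) \<noteq> d"
      using k B inj \<open>j \<in> B\<close> \<open>j \<noteq> k\<close> inj_onD[OF inj, of j k] by auto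
    ultimately have "degree (M j) < d"
      by simp
    then show ?thesis
      by (simp add: coeff_eq_0)
  qed simp
  have "0 = (\<Sum>j\<in>A. coeff (smult (c j) (M j)) d)"
    using sum by (metis coeff_0 coeff_sum)
  also have "\<dots> = coeff (smult (c k) (M k)) d"
  proof -
    have "(\<Sum>j\<in>A - {k}. coeff (smult (c j) (M j)) d) = 0"
      by (intro sum.neutral ballI small)
    moreover have "k \<in> A"
      using k B by auto
    ultimately show ?thesis
      by (simp only: sum.remove[OF fin] add_0_right)
  qed
  finally show False
    using k M[of k] by (auto simp: B_def)
qed

definition polys_over :: "nat \<Rightarrow> 'a :: field_prime_char poly set" where
  "polys_over m = {P. \<forall>i. coeff P i \<in> GF m}"

lemma polys_over_monom: "c \<in> GF m \<Longrightarrow> monom c k \<in> polys_over m"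
  by (simp add: polys_over_def)

lemma polys_over_add: "P \<in> polys_over m \<Longrightarrow> Q \<in> polys_over m \<Longrightarrow> P + Q \<in> polys_over m"
  by (simp add: polys_over_def GF_add)

lemma polys_over_diff: "P \<in> polys_over m \<Longrightarrow> Q \<in> polys_over m \<Longrightarrow> P - Q \<in> polys_over m"
  by (simp add: polys_over_def GF_diff)

lemma polys_over_sum: "(\<And>i. i \<in> A \<Longrightarrow> f i \<in> polys_over m) \<Longrightarrow> sum f A \<in> polys_over m"
  by (simp add: polys_over_def coeff_sum GF_sum)

lemma polys_over_mult: "P \<in> polys_over m \<Longrightarrow> Q \<in> polys_over m \<Longrightarrow> P * Q \<in> polys_over m"
  by (simp add: polys_over_def coeff_mult GF_sum GF_mult)

lemma polys_over_smult: "c \<in> GF m \<Longrightarrow> Q \<in> polys_over m \<Longrightarrow> smult c Q \<in> polys_over m"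
  by (simp add: polys_over_def GF_mult)

lemma polys_over_power: "P \<in> polys_over m \<Longrightarrow> P ^ n \<in> polys_over m"
proof (induction n)
  case 0
  have "1 = monom (1 :: 'a) 0"
    by (simp add: monom_0 one_pCons)
  then show ?case
    using polys_over_monom[of 1 m 0] by simp
qed (simp add: polys_over_mult)

text \<open>
  A homogeneous linear system with more unknowns than equations over a finite field has a nontrivial
  solution: there are more coefficient families than possible values of the sum, so two families
  give the same sum, and their difference is a solution.
\<close>

lemma polys_over_dependent:
  fixes M :: "'i \<Rightarrow> 'a :: {alg_closed_field, field_prime_char} poly"
  assumes m: "m > 0" and fin: "finite A" and M: "\<And>i. i \<in> A \<Longrightarrow> M i \<in> polys_over m"
    and deg: "\<And>i. i \<in> A \<Longrightarrow> degree (M i) < E" and card: "E < card A"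
  obtains c where "\<And>i. i \<in> A \<Longrightarrow> c i \<in> GF m" "\<exists>i\<in>A. c i \<noteq> 0" "(\<Sum>i\<in>A. smult (c i) (M i)) = 0"
proof -
  define S where "S c = (\<Sum>i\<in>A. smult (c i) (M i))" for c
  define F where "F c = restrict (coeff (S c)) {..<E}" for c
  let ?C = "A \<rightarrow>\<^sub>E (GF m :: 'a set)" and ?V = "{..<E} \<rightarrow>\<^sub>E (GF m :: 'a set)"
  have FV: "F ` ?C \<subseteq> ?V"
  proof -
    have "S c \<in> polys_over m" if "c \<in> ?C" for c
      unfolding S_def using that by (intro polys_over_sum polys_over_smult M) (auto dest: PiE_mem)
    then show ?thesis
      by (auto simp: F_def polys_over_def split: if_splits)
  qed
  have q: "card (GF m :: 'a set) > 1"
  proof -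
    have "CHAR('a) > 1"
      using prime_gt_1_nat CHAR_prime by blast
    then show ?thesis
      using one_less_power[OF _ m] m by (simp only: finite_card_GF)
  qed
  have "card ?V < card ?C"
    using card q fin by (simp add: card_PiE power_strict_increasing)
  moreover have "finite ?V"
    using m by (intro finite_PiE) (auto simp: finite_card_GF)
  ultimately have "\<not> inj_on F ?C"
    using card_inj_on_le[OF _ FV] by fastforce
  then obtain c d where cd: "c \<in> ?C" "d \<in> ?C" "c \<noteq> d" "F c = F d"
    by (auto simp: inj_on_def)
  define e where "e i = c i - d i" for i
  have "S c - S d = 0"
  proof (rule poly_eqI)
    fix k
    show "coeff (S c - S d) k = coeff 0 k"
    proof (cases "k < E")
      case True
      then show ?thesis
        using fun_cong[OF cd(4), of k] by (simp add: F_def)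
    next
      case False
      then have "coeff (M i) k = 0" if "i \<in> A" for i
        using deg[OF that] by (intro coeff_eq_0) simp
      then show ?thesis
        by (simp add: S_def coeff_sum)
    qed
  qed
  then have "(\<Sum>i\<in>A. smult (e i) (M i)) = 0"
    by (simp add: S_def e_def smult_diff_left sum_subtractf)
  moreover have "\<exists>i\<in>A. e i \<noteq> 0"
  proof (rule ccontr)
    assume "\<not> ?thesis"
    then have "c i = d i" if "i \<in> A" for i
      using that by (simp add: e_def)
    then have "c = d"
      by (rule PiE_ext[OF cd(1,2)])
    with cd(3) show False ..
  qed
  moreover have "e i \<in> GF m" if "i \<in> A" for i
    using cd that by (auto simp: e_def intro!: GF_diff dest: PiE_mem)
  ultimately show thesis
    using that by blast
qed

section \<open>Stepanov's method\<close>

text \<open>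
  These sums are, up to a constant, the degrees of the auxiliary polynomials used below. With \<open>r = p \<rho>\<close> and
  \<open>N = (r - 1) / (p - 1)\<close>, multiplication by \<open>p - 1\<close> turns such a sum into \<open>\<rho> u + v\<close>, where
  \<open>u = p (p - 1) k + (p - 1) j + p e\<close> and \<open>v = (p - 1) i - e\<close>. The values \<open>v\<close> range over an
  interval of length less than \<open>\<rho>\<close>, so \<open>u\<close> and \<open>v\<close> are determined. Then \<open>v\<close> gives \<open>e\<close> and \<open>i\<close>, and \<open>u\<close> gives
  \<open>j\<close> and \<open>k\<close>.
\<close>

lemma digits_unique:
  fixes p \<rho> N I :: nat
  assumes p: "p > 2" and N: "(p - 1) * N = p * \<rho> - 1" and \<rho>: "\<rho> > 0" and I: "(p - 1) * I \<le> \<rho>"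
    and eq: "i + p * \<rho> * k + \<rho> * j + N * e = i' + p * \<rho> * k' + \<rho> * j' + N * e'"
    and lt: "i < I" "i' < I" "j < p" "j' < p" "e < p - 1" "e' < p - 1"
  shows "i = i' \<and> j = j' \<and> e = e' \<and> k = k'"
proof -
  define P R where "P = int p - 1" and "R = int \<rho>"
  have P: "P \<ge> 2" "int p = P + 1" and R: "R > 0"
    using p \<rho> by (auto simp: P_def R_def)
  have "int ((p - 1) * N) = int (p * \<rho> - 1)"
    using N by simp
  then have N': "P * int N = (P + 1) * R - 1"
    using p \<rho> by (simp add: P_def R_def of_nat_diff)
  define u where "u = P * (P + 1) * int k + P * int j + (P + 1) * int e"
  define u' where "u' = P * (P + 1) * int k' + P * int j' + (P + 1) * int e'"
  define v where "v = P * int i - int e"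
  define v' where "v' = P * int i' - int e'"
  have "P * int (i + p * \<rho> * k + \<rho> * j + N * e) = R * u + v"
  proof -
    have "P * int (i + p * \<rho> * k + \<rho> * j + N * e) =
       P * int i + P * (P + 1) * R * int k + P * R * int j + (P * int N) * int e"
      by (simp add: P R_def algebra_simps)
    then show ?thesis
      unfolding N' by (simp add: u_def v_def algebra_simps)
  qed
  moreover have "P * int (i' + p * \<rho> * k' + \<rho> * j' + N * e') = R * u' + v'"
  proof -
    have "P * int (i' + p * \<rho> * k' + \<rho> * j' + N * e') =
       P * int i' + P * (P + 1) * R * int k' + P * R * int j' + (P * int N) * int e'"
      by (simp add: P R_def algebra_simps)
    then show ?thesis
      unfolding N' by (simp add: u'_def v'_def algebra_simps)
  qed
  ultimately have "R * u + v = R * u' + v'"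
    by (simp only: eq)
  then have uv: "R * (u - u') = v' - v"
    by (simp add: algebra_simps)
  have "int ((p - 1) * I) \<le> int \<rho>"
    using I by (simp only: of_nat_le_iff)
  then have PI: "P * int I \<le> R"
    using p by (simp add: P_def R_def of_nat_diff)
  have e: "int e < P" "int e' < P"
    using lt p by (auto simp: P_def)
  have bounds: "P * int x \<le> P * int I - P" if "x < I" for x
    using mult_left_mono[of "int x" "int I - 1" P] that P by (simp add: algebra_simps)
  have "\<bar>v' - v\<bar> < R"
    using bounds[of i] bounds[of i'] lt e PI P mult_nonneg_nonneg[of P "int i"]
      mult_nonneg_nonneg[of P "int i'"] unfolding v_def v'_def by linarith
  then have "\<bar>u - u'\<bar> * R < 1 * R"
    using R by (simp add: uv[symmetric] abs_mult mult.commute)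
  then have "u = u'"
    using R by (subst (asm) mult_less_cancel_right_pos) auto
  then have v: "v = v'"
    using uv by simp
  have "P dvd int e - int e'"
    using v by (intro dvdI[of _ _ "int i - int i'"]) (simp add: v_def v'_def algebra_simps)
  then have "int e - int e' = 0"
    using e dvd_imp_le_int[of "int e - int e'" P] by fastforce
  then have ee: "e = e'"
    by simp
  then have ii: "i = i'"
    using v P by (simp add: v_def v'_def)
  have "P * ((P + 1) * int k + int j) = P * ((P + 1) * int k' + int j')"
    using \<open>u = u'\<close> ee by (simp add: u_def u'_def algebra_simps)
  then have "(P + 1) * int k + int j = (P + 1) * int k' + int j'"
    using P by simp
  then have "int (p * k + j) = int (p * k' + j')"
    by (simp add: P)
  then have "p * k + j = p * k' + j'"
    by (simp only: of_nat_eq_iff)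
  then have "(p * k + j) mod p = (p * k' + j') mod p" "(p * k + j) div p = (p * k' + j') div p"
    by simp_all
  then show ?thesis
    using lt ee ii p by simp
qed

text \<open>
  The trace of \<open>a x + b / x\<close> down to the prime field, cleared of denominators by the factor \<open>x^(p^(n - 1))\<close>.
\<close>

definition trace_poly :: "nat \<Rightarrow> 'a \<Rightarrow> 'a \<Rightarrow> 'a :: field_prime_char poly" where
  "trace_poly n a b = (\<Sum>i<n. monom a (CHAR('a) ^ (n - 1) + CHAR('a) ^ i) + monom b (CHAR('a) ^ (n - 1) - CHAR('a) ^ i))"

lemma poly_trace_poly:
  fixes a b x :: "'a :: field_prime_char"
  assumes "a \<in> GF 1" "b \<in> GF 1" "x \<noteq> 0"
  shows "poly (trace_poly n a b) x = x ^ (CHAR('a) ^ (n - 1)) * ftrace n (a * x + b / x)"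
proof -
  have "poly (monom a (CHAR('a) ^ (n - 1) + CHAR('a) ^ i) + monom b (CHAR('a) ^ (n - 1) - CHAR('a) ^ i)) x =
        x ^ (CHAR('a) ^ (n - 1)) * (a * x + b / x) ^ (CHAR('a) ^ i)" if "i < n" for i
  proof -
    have "a ^ (CHAR('a) ^ i) = a" "b ^ (CHAR('a) ^ i) = b"
      using GF_prime[OF assms(1), of i] GF_prime[OF assms(2), of i] by (simp_all add: GF_def)
    moreover have "CHAR('a) ^ i \<le> CHAR('a) ^ (n - 1)"
      using that by (intro power_increasing) (auto simp: Suc_le_eq)
    ultimately show ?thesis
      using assms(3)
      by (simp add: poly_monom frob_add power_mult_distrib power_divide power_add power_diff algebra_simps)
  qed
  then show ?thesis
    by (simp add: trace_poly_def ftrace_def poly_sum sum_distrib_left)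
qed

lemma degree_trace_poly:
  fixes a b :: "'a :: field_prime_char"
  assumes "n > 0" "a \<noteq> 0"
  shows "degree (trace_poly n a b) = 2 * CHAR('a) ^ (n - 1)" "trace_poly n a b \<noteq> 0"
proof -
  let ?\<rho> = "CHAR('a) ^ (n - 1)"
  have p: "CHAR('a) > 1"
    using prime_gt_1_nat CHAR_prime by blast
  have le: "CHAR('a) ^ i \<le> ?\<rho>" if "i < n" for i
    using that by (intro power_increasing) (auto simp: Suc_le_eq)
  have "degree (monom a (?\<rho> + CHAR('a) ^ i) + monom b (?\<rho> - CHAR('a) ^ i)) \<le> 2 * ?\<rho>" if "i < n" for i
    using le[OF that] by (intro degree_add_le order_trans[OF degree_monom_le]) auto
  then have "degree (trace_poly n a b) \<le> 2 * ?\<rho>"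
    unfolding trace_poly_def by (intro degree_sum_le) auto
  moreover have "coeff (trace_poly n a b) (2 * ?\<rho>) = (\<Sum>i<n. if i = n - 1 then a else 0)"
    unfolding trace_poly_def coeff_sum
  proof (intro sum.cong refl)
    fix i assume "i \<in> {..<n}"
    have "?\<rho> + CHAR('a) ^ i = 2 * ?\<rho> \<longleftrightarrow> i = n - 1"
      using p by (simp add: mult_2 power_inject_exp)
    moreover have "?\<rho> - CHAR('a) ^ i \<noteq> 2 * ?\<rho>"
      using p zero_less_power[of "CHAR('a)" "n - 1"] by linarith
    ultimately show "coeff (monom a (?\<rho> + CHAR('a) ^ i) + monom b (?\<rho> - CHAR('a) ^ i)) (2 * ?\<rho>) =
        (if i = n - 1 then a else 0)"
      by simp
  qed
  moreover have "(\<Sum>i<n. if i = n - 1 then a else 0) = a"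
    using assms by simp
  ultimately show "degree (trace_poly n a b) = 2 * ?\<rho>" "trace_poly n a b \<noteq> 0"
    using assms le_degree[of "trace_poly n a b" "2 * ?\<rho>"] by (auto intro: le_antisym)
qed

lemma polys_over_trace_poly: "a \<in> GF m \<Longrightarrow> b \<in> GF m \<Longrightarrow> trace_poly n a b \<in> polys_over m"
  unfolding trace_poly_def by (intro polys_over_sum polys_over_add polys_over_monom)

lemma geometric_sum_nat: "p > 0 \<Longrightarrow> (p - 1) * (\<Sum>i<n. p ^ i) = p ^ n - (1 :: nat)"
  by (induction n) (auto simp: algebra_simps Suc_diff_le)

text \<open>
  Let \<open>q = r^2\<close> be the number of elements of the field. On the set in question put
  \<open>\<sigma> = x^N\<close>, the norm of \<open>x\<close> from the field with \<open>r\<close> elements, extended by the same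
  formula, and likewise let \<open>\<tau>\<close> be the corresponding trace of \<open>a x + b / x\<close>. Raising to the power \<open>r\<close> is an
  involution of the field, and the conditions on norm and trace say that it acts by
  \<open>\<sigma>^r = z / \<sigma>\<close> and \<open>\<tau>^r = t - \<tau>\<close>. Consider
  \<open>G = \<Sum> c^r x^(i + r k) \<sigma>^e \<tau>^j\<close> with indices \<open>i < I\<close>, \<open>j < p\<close>, \<open>e < p - 1\<close>, \<open>k < K\<close>. On the
  set, \<open>G^r\<close> equals \<open>\<Sum> c x^(r i + k) (z / \<sigma>)^e (t - \<tau>)^j\<close>, which is again a
  polynomial in \<open>x\<close> after multiplication by a monomial and whose degree is only about \<open>r I\<close>. There are
  \<open>p (p - 1) I K\<close> unknowns \<open>c\<close>, so with \<open>K\<close> slightly above \<open>r / (p (p - 1))\<close> they can be chosen,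
  not all zero, such that this polynomial vanishes identically. Then \<open>G\<close> vanishes on the set. It is not the zero
  polynomial, because its terms have distinct degrees, and its degree is about \<open>r K\<close>.
\<close>

lemma stepanov_bound:
  fixes a b z t :: "'a :: {alg_closed_field, field_prime_char}"
  assumes p2: "CHAR('a) > 2" and n: "n > 0"
    and a: "a \<in> GF 1 - {0}" and b: "b \<in> GF 1 - {0}" and z: "z \<in> GF 1 - {0}" and t: "t \<in> GF 1"
    and big: "CHAR('a) ^ n \<ge> CHAR('a) * (CHAR('a) - 1)"
  defines "r \<equiv> CHAR('a) ^ n" and "D \<equiv> CHAR('a) * (CHAR('a) - 1)"
  shows "card {x \<in> GF (2 * n) - {0}. fnorm (2 * n) x = z \<and> ftrace (2 * n) (a * x + b / x) = t}
           \<le> r * (r div D) + 9 * r"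
proof -
  define p where "p = CHAR('a)"
  define \<rho> where "\<rho> = p ^ (n - 1)"
  define N where "N = (\<Sum>i<n. p ^ i)"
  define I where "I = r div D"
  define K where "K = I + 6"
  define E where "E = r * I + K + 2 * r"
  define g where "g = trace_poly n a b"
  define A where "A = {..<I} \<times> {..<p} \<times> {..<p - 1} \<times> {..<K}"
  \<comment> \<open>The polynomials \<open>x^(i + r k) \<sigma>^e \<tau>^j\<close>, multiplied by \<open>x^(\<rho> (p - 1))\<close>, and their \<open>r\<close>-th powers in
    reduced form, where negative powers of \<open>\<sigma>\<close> are cleared by \<open>\<sigma>^(p - 2)\<close>. The surplus 6 in \<open>K\<close>
    pays for these factors.\<close>
  define M where "M = (\<lambda>(i, j, e, k). monom 1 (i + r * k + \<rho> * (p - 1 - j) + N * e) * g ^ j)"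
  define M' where "M' = (\<lambda>(i, j, e, k). smult (z ^ e)
     (monom 1 (r * i + k + \<rho> * (p - 1 - j) + N * (p - 2 - e)) * (monom t \<rho> - g) ^ j))"
  have p: "p > 2"
    using p2 by (simp add: p_def)
  have r: "r = p * \<rho>" and \<rho>: "\<rho> > 0"
    using n p by (simp_all add: r_def \<rho>_def p_def flip: power_Suc)
  have N: "(p - 1) * N = p * \<rho> - 1"
    using geometric_sum_nat[of p n] p by (simp add: N_def r[symmetric]) (simp add: r_def p_def)
  have D: "D \<ge> 6"
    using mult_le_mono[of 3 p 2 "p - 1"] p by (simp add: D_def p_def)
  have "r \<ge> D"
    using big by (simp add: r_def D_def)
  then have I0: "I \<ge> 1"
    using D by (simp add: I_def div_greater_zero_iff Suc_le_eq)
  have rI: "D * I \<le> r" "r < D * (I + 1)"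
    using D dividend_less_times_div[of D r] by (simp_all add: I_def)
  have "p * ((p - 1) * I) \<le> p * \<rho>"
    using rI by (simp add: D_def p_def r mult.assoc)
  then have pI: "(p - 1) * I \<le> \<rho>"
    using p by simp
  have Np: "N * (p - 2) \<le> r"
  proof -
    have "N * (p - 2) \<le> N * (p - 1)"
      by (intro mult_le_mono2) simp
    also have "N * (p - 1) \<le> r"
      by (simp only: mult.commute[of N] N r diff_le_self)
    finally show ?thesis .
  qed
  have \<rho>p: "\<rho> * (p - 1) \<le> r"
    by (simp add: r algebra_simps)
  have g: "degree g = 2 * \<rho>" "g \<noteq> 0"
    using degree_trace_poly[OF n, of a b] a by (auto simp: g_def \<rho>_def p_def)
  have degM: "degree (M (i, j, e, k)) = \<rho> * (p - 1) + (i + p * \<rho> * k + \<rho> * j + N * e)" if "j < p" for i j e k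
  proof -
    have "\<rho> * (p - 1 - j) + 2 * \<rho> * j = \<rho> * (p - 1) + \<rho> * j"
    proof -
      have "\<rho> * (p - 1) = \<rho> * (p - 1 - j) + \<rho> * j"
        using that by (simp flip: distrib_left)
      then show ?thesis
        by simp
    qed
    then show ?thesis
      using g by (simp add: M_def degree_mult_eq degree_monom_eq degree_power_eq r algebra_simps)
  qed
  have finA: "finite A"
    by (simp add: A_def)
  have inj: "inj_on (\<lambda>i. degree (M i)) A"
  proof (rule inj_onI)
    fix u v assume uv: "u \<in> A" "v \<in> A" "degree (M u) = degree (M v)"
    obtain i j e k i' j' e' k' where ijek: "u = (i, j, e, k)" "v = (i', j', e', k')"
      by (metis prod_cases4)
    show "u = v"
      using digits_unique[OF p N \<rho> pI, of i k j e i' k' j' e'] uv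
      by (simp add: ijek degM A_def)
  qed
  have M0: "M i \<noteq> 0" if "i \<in> A" for i
    using g that by (auto simp: M_def A_def)
  have cardA: "card A = D * I * (I + 6)"
    by (simp add: A_def D_def K_def p_def)
  have "E < card A"
  proof -
    have "(r + 1) * (I + 2) \<le> (D * (I + 1)) * (I + 2)"
      using rI by (intro mult_le_mono1) simp
    moreover have "(r + 1) * (I + 2) = r * I + 2 * r + I + 2"
      "(D * (I + 1)) * (I + 2) = D * I * I + 3 * (D * I) + 2 * D"
      "D * I * (I + 6) = D * I * I + 6 * (D * I)"
      by (simp_all add: algebra_simps)
    moreover have "D \<le> D * I"
      using I0 by simp
    ultimately show ?thesis
      using D unfolding cardA E_def K_def by linarith
  qed
  have degM': "degree (M' i) < E" if "i \<in> A" for i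
  proof -
    obtain i1 j e k where i: "i = (i1, j, e, k)"
      by (metis prod_cases4)
    have lt: "i1 < I" "j < p" "e < p - 1" "k < K"
      using that by (auto simp: A_def i)
    have "degree (monom t \<rho> - g) \<le> 2 * \<rho>"
      using g by (intro degree_diff_le order_trans[OF degree_monom_le]) auto
    then have "degree ((monom t \<rho> - g) ^ j) \<le> 2 * \<rho> * j"
      using degree_power_le[of "monom t \<rho> - g" j] mult_le_mono1 order_trans by blast
    then have "degree (M' i) \<le> r * i1 + k + \<rho> * (p - 1 - j) + N * (p - 2 - e) + 2 * \<rho> * j"
      unfolding i M'_def prod.case
      by (intro order_trans[OF degree_smult_le] order_trans[OF degree_mult_le] add_mono degree_monom_le)
    moreover have "\<rho> * (p - 1 - j) + 2 * \<rho> * j \<le> 2 * r"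
    proof -
      have "\<rho> * (p - 1) = \<rho> * (p - 1 - j) + \<rho> * j"
        using lt by (simp flip: distrib_left)
      moreover have "\<rho> * j \<le> \<rho> * (p - 1)"
        using lt by (intro mult_le_mono) auto
      ultimately show ?thesis
        using \<rho>p by simp
    qed
    moreover have "N * (p - 2 - e) \<le> r"
      using Np by (meson diff_le_self le_trans mult_le_mono2)
    moreover have "r * i1 + r \<le> r * I"
      using mult_le_mono2[of "i1 + 1" I r] lt by (simp add: algebra_simps)
    ultimately show ?thesis
      using lt unfolding E_def by linarith
  qed
  have aq: "a \<in> GF (2 * n)" "b \<in> GF (2 * n)" "z \<in> GF (2 * n)" "t \<in> GF (2 * n)"
    using a b z t GF_prime by auto
  have M'over: "M' i \<in> polys_over (2 * n)" if "i \<in> A" for i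
    using aq unfolding M'_def g_def
    by (auto intro!: polys_over_smult polys_over_mult polys_over_monom polys_over_power polys_over_diff
        polys_over_trace_poly GF_power split: prod.split)
  obtain c where c: "\<And>i. i \<in> A \<Longrightarrow> c i \<in> GF (2 * n)" "\<exists>i\<in>A. c i \<noteq> 0" "(\<Sum>i\<in>A. smult (c i) (M' i)) = 0"
    by (rule polys_over_dependent[OF _ finA M'over degM' \<open>E < card A\<close>]) (use n in \<open>simp | blast\<close>)+
  define G where "G = (\<Sum>i\<in>A. smult (c i ^ r) (M i))"
  have "G \<noteq> 0"
  proof
    assume "G = 0"
    then have "c i ^ r = 0" if "i \<in> A" for i
      using distinct_degrees_independent[OF finA inj M0, of "\<lambda>i. c i ^ r" i] that by (simp add: G_def)
    then show False
      using c(2) by auto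
  qed
  have rr: "CHAR('a) ^ (2 * n) = r * r"
    by (simp add: r_def power_add mult_2)
  have pow_rr: "(x ^ r) ^ r = x" if "x \<in> GF (2 * n)" for x :: 'a
    using that unfolding GF_def mem_Collect_eq power_mult[symmetric] rr .
  have "degree G \<le> r * I + 9 * r"
    unfolding G_def
  proof (intro degree_sum_le finA order_trans[OF degree_smult_le])
    fix i assume "i \<in> A"
    obtain i1 j e k where i: "i = (i1, j, e, k)"
      by (metis prod_cases4)
    have lt: "i1 < I" "j < p" "e < p - 1" "k < K"
      using \<open>i \<in> A\<close> by (auto simp: A_def i)
    have "p * \<rho> * k \<le> r * (I + 5)"
      using lt unfolding r[symmetric] K_def by (intro mult_le_mono2) simp
    moreover have "\<rho> * j \<le> \<rho> * (p - 1)" "N * e \<le> N * (p - 2)"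
      using lt by (intro mult_le_mono2; simp)+
    moreover have "I \<le> r"
      by (simp add: I_def)
    ultimately show "degree (M i) \<le> r * I + 9 * r"
      using Np \<rho>p lt unfolding i degM[OF lt(2)] by (simp add: algebra_simps)
  qed
  moreover have "{x \<in> GF (2 * n) - {0}. fnorm (2 * n) x = z \<and> ftrace (2 * n) (a * x + b / x) = t}
      \<subseteq> {x. poly G x = 0}"
  proof (intro subsetI)
    fix x assume "x \<in> {x \<in> GF (2 * n) - {0}. fnorm (2 * n) x = z \<and> ftrace (2 * n) (a * x + b / x) = t}"
    then have x: "x \<in> GF (2 * n)" "x \<noteq> 0" "fnorm (2 * n) x = z" "ftrace (2 * n) (a * x + b / x) = t"
      by auto
    define \<sigma> where "\<sigma> = fnorm n x"
    define \<tau> where "\<tau> = ftrace n (a * x + b / x)"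
    have \<sigma>: "\<sigma> = x ^ N" "\<sigma> * \<sigma> ^ r = z" "\<sigma> \<noteq> 0"
    proof -
      show "\<sigma> = x ^ N"
        by (simp add: \<sigma>_def fnorm_def N_def p_def)
      show "\<sigma> * \<sigma> ^ r = z"
        using x(3) unfolding fnorm_double fnorm_mult r_def[symmetric]
        by (simp add: \<sigma>_def fnorm_def power_mult [symmetric] mult.commute)
      show "\<sigma> \<noteq> 0"
        using x by (simp add: \<sigma>_def fnorm_def)
    qed
    have "ftrace n (y ^ r) = ftrace n y ^ r" for y :: 'a
      by (simp add: ftrace_def r_def frob_sum power_mult [symmetric] mult.commute)
    then have "ftrace (2 * n) y = ftrace n y + ftrace n y ^ r" for y :: 'a
      using ftrace_add[of n y "y ^ r"] by (simp only: ftrace_double r_def)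
    then have "\<tau> + \<tau> ^ r = t"
      using x(4) by (simp only: \<tau>_def)
    then have \<tau>: "\<tau> ^ r = t - \<tau>"
      by (simp only: eq_diff_eq add.commute)
    have gx: "poly g x = x ^ \<rho> * \<tau>"
      using poly_trace_poly[of a b x n] a b x by (simp add: g_def \<tau>_def \<rho>_def p_def)
    \<comment> \<open>The \<open>r\<close>-th power of \<open>M i\<close> and the reduced form \<open>M' i\<close> agree up to factors which are nonzero
      at \<open>x\<close> and do not depend on \<open>i\<close>.\<close>
    have key: "x ^ (r * \<rho> * (p - 1)) * poly (M' i) x = poly (M i) x ^ r * (x ^ (\<rho> * (p - 1)) * \<sigma> ^ (p - 2))"
      if "i \<in> A" for i
    proof -
      obtain i1 j e k where i: "i = (i1, j, e, k)"
        by (metis prod_cases4)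
      have lt: "j < p" "e < p - 1"
        using \<open>i \<in> A\<close> by (auto simp: A_def i)
      have j: "x ^ (\<rho> * (p - 1 - j)) * (x ^ \<rho>) ^ j = x ^ (\<rho> * (p - 1))"
        using lt by (simp add: power_mult [symmetric] power_add [symmetric] distrib_left [symmetric])
      have "poly (M i) x = x ^ (i1 + r * k) * \<sigma> ^ e * \<tau> ^ j * (x ^ (\<rho> * (p - 1 - j)) * (x ^ \<rho>) ^ j)"
        by (simp add: i M_def poly_monom gx \<sigma> power_add power_mult power_mult_distrib mult_ac)
      then have M: "poly (M i) x = x ^ (i1 + r * k) * \<sigma> ^ e * \<tau> ^ j * x ^ (\<rho> * (p - 1))"
        by (simp only: j)
      have "(x ^ (i1 + r * k)) ^ r = x ^ (r * i1) * ((x ^ k) ^ r) ^ r"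
        by (simp only: power_add power_mult_distrib power_mult [symmetric] mult_ac)
      then have pw: "(x ^ (i1 + r * k)) ^ r = x ^ (r * i1 + k)"
        by (simp only: pow_rr[OF GF_power[OF x(1)]] power_add)
      have Mr: "poly (M i) x ^ r = x ^ (r * i1 + k) * (\<sigma> ^ r) ^ e * (\<tau> ^ r) ^ j * x ^ (r * \<rho> * (p - 1))"
        unfolding M power_mult_distrib pw by (simp only: power_mult [symmetric] mult_ac)
      have "poly (M' i) x = z ^ e * x ^ (r * i1 + k) * \<sigma> ^ (p - 2 - e) * (x ^ (\<rho> * (p - 1 - j)) * (x ^ \<rho> * (t - \<tau>)) ^ j)"
      proof -
        have "t * x ^ \<rho> - x ^ \<rho> * \<tau> = x ^ \<rho> * (t - \<tau>)"
          by (simp add: algebra_simps)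
        then show ?thesis
          unfolding i M'_def prod.case poly_smult poly_mult poly_monom poly_power poly_diff gx \<sigma>(1)
          by (simp only: power_add power_mult[of x N] mult_1 mult_ac)
      qed
      also have "\<dots> = z ^ e * x ^ (r * i1 + k) * \<sigma> ^ (p - 2 - e) * (x ^ (\<rho> * (p - 1)) * (\<tau> ^ r) ^ j)"
        by (simp only: \<tau> power_mult_distrib j mult.assoc [symmetric])
      also have "\<dots> = (\<sigma> ^ r) ^ e * x ^ (r * i1 + k) * (\<sigma> ^ e * \<sigma> ^ (p - 2 - e)) * (x ^ (\<rho> * (p - 1)) * (\<tau> ^ r) ^ j)"
        by (simp only: \<sigma>(2) [symmetric] power_mult_distrib mult_ac)
      also have "\<sigma> ^ e * \<sigma> ^ (p - 2 - e) = \<sigma> ^ (p - 2)"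
        using lt by (simp flip: power_add)
      finally show ?thesis
        by (simp only: Mr mult_ac)
    qed
    have "poly G x ^ r * (x ^ (\<rho> * (p - 1)) * \<sigma> ^ (p - 2)) =
          (\<Sum>i\<in>A. c i * (poly (M i) x ^ r * (x ^ (\<rho> * (p - 1)) * \<sigma> ^ (p - 2))))"
    proof -
      have "poly G x ^ r = (\<Sum>i\<in>A. (c i ^ r * poly (M i) x) ^ r)"
        by (simp add: G_def poly_sum frob_sum r_def)
      also have "\<dots> = (\<Sum>i\<in>A. c i * poly (M i) x ^ r)"
        by (intro sum.cong refl) (simp only: power_mult_distrib pow_rr[OF c(1)])
      finally show ?thesis
        by (simp only: sum_distrib_right mult.assoc)
    qed
    also have "\<dots> = (\<Sum>i\<in>A. c i * (x ^ (r * \<rho> * (p - 1)) * poly (M' i) x))"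
      by (intro sum.cong refl) (simp only: key)
    also have "\<dots> = x ^ (r * \<rho> * (p - 1)) * poly (\<Sum>i\<in>A. smult (c i) (M' i)) x"
      by (simp add: poly_sum sum_distrib_left mult.left_commute)
    finally show "x \<in> {x. poly G x = 0}"
      using x \<sigma> unfolding c(3) by simp
  qed
  ultimately show ?thesis
    using card_mono[OF poly_roots_finite[OF \<open>G \<noteq> 0\<close>]] card_poly_roots_bound[OF \<open>G \<noteq> 0\<close>]
    unfolding I_def by (meson order_trans)
qed

section \<open>Weil's bound\<close>

context finite_field_characters
begin

text \<open>
  The summand is constant on each class of elements with given norm and given trace of \<open>a x + b / x\<close>. Stepanov's
  bound gives an upper bound \<open>U\<close> for all class sizes. Replacing each size \<open>C y\<close> by the deficit \<open>U - C y\<close> only changes the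
  sign of the whole sum, as the weights add up to 0. The deficits are nonnegative and their total is small, because
  the average of the class sizes is nearly \<open>U\<close>. So an upper bound for the class sizes suffices.
\<close>

lemma kloosterman_square_root_order:
  assumes p2: "CHAR('a) > 2" and n: "n > 0" and a: "a \<in> GF 1 - {0}" and b: "b \<in> GF 1 - {0}"
    and big: "CHAR('a) ^ n \<ge> CHAR('a) * (CHAR('a) - 1)"
  shows "norm (kloosterman (2 * n) a b) \<le> (9 * real (CHAR('a) * (CHAR('a) - 1)) + 1) * real (CHAR('a) ^ n)"
proof -
  define r D where "r = CHAR('a) ^ n" and "D = CHAR('a) * (CHAR('a) - 1)"
  define U where "U = r * (r div D) + 9 * r"
  define S where "S = GF (2 * n) - {0 :: 'a}"
  define T where "T = (GF 1 - {0 :: 'a}) \<times> (GF 1 :: 'a set)"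
  define \<phi> where "\<phi> x = (fnorm (2 * n) x, ftrace (2 * n) (a * x + b / x))" for x
  define w where "w y = \<eta> (fst y) * \<psi> (snd y)" for y
  define C where "C y = card {x \<in> S. \<phi> x = y}" for y
  have ab: "a \<in> GF (2 * n)" "b \<in> GF (2 * n)"
    using a b GF_prime by auto
  have fin: "finite S" "finite T"
    using n by (simp_all add: S_def T_def finite_card_GF)
  have cardS: "card S = r * r - 1"
    using n by (simp add: S_def r_def finite_card_GF power_add mult_2)
  have cardT: "card T = D"
    by (simp add: T_def D_def card_cartesian_product finite_card_GF mult.commute)
  have \<phi>T: "\<phi> ` S \<subseteq> T"
  proof (intro image_subsetI)
    fix x assume x: "x \<in> S"
    have "a * x + b / x \<in> GF (2 * n)"
      using ab x by (auto simp: S_def intro!: GF_add GF_mult GF_divide)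
    then show "\<phi> x \<in> T"
      using n x fnorm_nonzero[of "2 * n" x] ftrace_in_prime_field by (simp add: S_def T_def \<phi>_def)
  qed
  have CU: "C y \<le> U" if "y \<in> T" for y
  proof -
    obtain z t where y: "y = (z, t)" "z \<in> GF 1 - {0}" "t \<in> GF 1"
      using \<open>y \<in> T\<close> by (auto simp: T_def)
    show ?thesis
      using stepanov_bound[OF p2 n a b y(2,3) big] unfolding y(1) C_def S_def \<phi>_def U_def r_def D_def
      by simp
  qed
  have "kloosterman (2 * n) a b = (\<Sum>x\<in>S. w (\<phi> x))"
    by (simp add: kloosterman_def S_def w_def \<phi>_def)
  also have "\<dots> = (\<Sum>y\<in>T. \<Sum>x\<in>{x \<in> S. \<phi> x = y}. w (\<phi> x))"
    by (rule sum.group [symmetric]) (use fin \<phi>T in auto)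
  also have "\<dots> = (\<Sum>y\<in>T. w y * of_nat (C y))"
    by (intro sum.cong refl) (simp add: C_def mult.commute)
  also have "\<dots> = - (\<Sum>y\<in>T. w y * of_nat (U - C y))"
  proof -
    have "(\<Sum>t\<in>GF 1. \<psi> t) = 0"
      using sum_additive_character[of 1 1] by simp
    then have "(\<Sum>y\<in>T. w y) = 0"
      unfolding T_def w_def by (simp add: sum_product [symmetric] sum.cartesian_product' )
    then have "(\<Sum>y\<in>T. w y * of_nat U) = 0"
      by (simp flip: sum_distrib_right)
    moreover have "w y * of_nat (U - C y) = w y * of_nat U - w y * of_nat (C y)" if "y \<in> T" for y
      using CU[OF that] by (simp add: of_nat_diff right_diff_distrib)
    ultimately show ?thesis
      by (simp add: sum_subtractf)
  qed
  finally have "norm (kloosterman (2 * n) a b) = norm (\<Sum>y\<in>T. w y * of_nat (U - C y))"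
    by simp
  also have "\<dots> \<le> (\<Sum>y\<in>T. norm (w y * of_nat (U - C y)))"
    by (rule norm_sum)
  also have "\<dots> = (\<Sum>y\<in>T. real U - real (C y))"
  proof (intro sum.cong refl)
    fix y assume y: "y \<in> T"
    then have "fst y \<in> GF 1 - {0}" "snd y \<in> GF 1"
      by (auto simp: T_def)
    then have "norm (w y) = 1"
      by (simp only: w_def norm_mult norm_eta norm_psi mult_1)
    then show "norm (w y * of_nat (U - C y)) = real U - real (C y)"
      using CU[OF y] by (simp only: norm_mult norm_of_nat mult_1 of_nat_diff [where ?'a = real])
  qed
  also have "\<dots> = real D * real U - real (\<Sum>y\<in>T. C y)"
    by (simp add: sum_subtractf cardT)
  also have "(\<Sum>y\<in>T. C y) = card S"
    using sum.group[OF fin \<phi>T, of "\<lambda>_. 1 :: nat"] by (simp add: C_def)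
  also have "real D * real U \<le> real (r * r + 9 * D * r)"
    unfolding of_nat_mult [symmetric] of_nat_le_iff U_def
    using mult_le_mono2[OF times_div_less_eq_dividend[of D r], of r] by (simp add: algebra_simps)
  also have "real (r * r + 9 * D * r) - real (card S) = 9 * real D * real r + 1"
  proof -
    have "r * r \<ge> 1"
      using CHAR_pos[where ?'a = 'a] by (simp add: r_def Suc_le_eq)
    then show ?thesis
      unfolding cardS by (simp add: of_nat_diff)
  qed
  also have "\<dots> \<le> (9 * real D + 1) * real r"
    using CHAR_pos[where ?'a = 'a] by (simp add: algebra_simps r_def Suc_le_eq flip: of_nat_power)
  finally show ?thesis
    by (simp add: r_def D_def)
qed

text \<open>
  The normalised absolute values \<open>\<theta> k\<close> of the sums over the fields with \<open>p^(2^k)\<close> elements satisfy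
  \<open>\<theta> (k + 1) \<ge> 2 (\<theta> k)^2 - 1\<close>. The excess over 1 thus grows by a factor 4 in each step, while
  all \<open>\<theta> k\<close> remain below a constant.
\<close>

theorem weil_bound:
  assumes p2: "CHAR('a) > 2" and a: "a \<in> GF 1 - {0}" and b: "b \<in> GF 1 - {0}"
  shows "norm (kloosterman 1 a b) \<le> 2 * sqrt (real CHAR('a))"
proof (rule ccontr)
  assume contra: "\<not> ?thesis"
  define p where "p = real CHAR('a)"
  define C where "C = 9 * real (CHAR('a) * (CHAR('a) - 1)) + 1"
  define s where "s k = sqrt p ^ (2 ^ k)" for k :: nat
  define \<theta> where "\<theta> k = norm (kloosterman (2 ^ k) a b) / (2 * s k)" for k
  define \<delta> where "\<delta> = \<theta> 0 - 1"
  have p: "p > 2"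
    using p2 by (simp add: p_def)
  have s: "s k > 0" "s (Suc k) = s k ^ 2" "s k ^ 2 = p ^ (2 ^ k)" for k
  proof -
    show "s k > 0"
      using p by (simp add: s_def)
    show "s (Suc k) = s k ^ 2"
      by (simp only: s_def power_Suc power_mult [symmetric] mult.commute)
    have "s k ^ 2 = (sqrt p ^ 2) ^ (2 ^ k)"
      by (simp only: s_def power_mult [symmetric] mult.commute)
    then show "s k ^ 2 = p ^ (2 ^ k)"
      using p by simp
  qed
  have step: "\<theta> (Suc k) \<ge> 2 * \<theta> k ^ 2 - 1" for k
  proof -
    let ?m = "2 ^ k :: nat"
    have ab: "- b / a \<in> GF ?m - {0}"
      using a b GF_prime[of a ?m] GF_prime[of b ?m] by (auto intro: GF_divide GF_uminus)
    have "norm (kloosterman ?m a b ^ 2) \<le> norm (kloosterman (2 * ?m) a b + kloosterman ?m a b ^ 2)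
       + norm (kloosterman (2 * ?m) a b)"
      using norm_triangle_ineq4[of "kloosterman (2 * ?m) a b + kloosterman ?m a b ^ 2" "kloosterman (2 * ?m) a b"]
      by simp
    also have "norm (kloosterman (2 * ?m) a b + kloosterman ?m a b ^ 2) = 2 * p ^ ?m"
      using kloosterman_quadratic_extension[OF _ a b, of ?m] norm_eta[OF fnorm_nonzero[OF _ ab]]
      by (simp add: norm_mult norm_power p_def)
    finally have "norm (kloosterman ?m a b) ^ 2 - 2 * s k ^ 2 \<le> norm (kloosterman (2 ^ Suc k) a b)"
      by (simp add: s norm_power)
    then have "(norm (kloosterman ?m a b) ^ 2 - 2 * s k ^ 2) / (2 * s k ^ 2) \<le> \<theta> (Suc k)"
      unfolding \<theta>_def s(2) by (intro divide_right_mono) auto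
    also have "(norm (kloosterman ?m a b) ^ 2 - 2 * s k ^ 2) / (2 * s k ^ 2) = 2 * \<theta> k ^ 2 - 1"
      using s(1)[of k] by (simp add: \<theta>_def power_divide power_mult_distrib field_simps)
    finally show ?thesis .
  qed
  have \<delta>: "\<delta> > 0"
    using contra p by (simp add: \<delta>_def \<theta>_def s_def p_def)
  have growth: "\<theta> k \<ge> 1 + 4 ^ k * \<delta>" for k
  proof (induction k)
    case (Suc k)
    have "1 + 4 ^ Suc k * \<delta> \<le> 2 * (1 + 4 ^ k * \<delta>) ^ 2 - 1"
      using \<delta> by (simp add: power2_eq_square algebra_simps)
    also have "\<dots> \<le> 2 * \<theta> k ^ 2 - 1"
      using Suc.IH \<delta> by (intro diff_right_mono mult_left_mono power_mono) auto
    also have "\<dots> \<le> \<theta> (Suc k)"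
      by (rule step)
    finally show ?case .
  qed (simp add: \<delta>_def)
  have upper: "\<theta> (Suc k) \<le> C / 2" if "k \<ge> 1" for k
  proof -
    let ?m = "2 ^ k :: nat"
    have "CHAR('a) * (CHAR('a) - 1) \<le> CHAR('a) ^ 2"
      by (simp add: power2_eq_square)
    also have "\<dots> \<le> CHAR('a) ^ ?m"
      using that power_increasing[of 1 k "2 :: nat"] by (intro power_increasing) (auto simp: Suc_le_eq)
    finally have "norm (kloosterman (2 * ?m) a b) \<le> C * p ^ ?m"
      using kloosterman_square_root_order[OF p2 _ a b, of ?m] by (simp add: C_def p_def)
    also have "p ^ ?m = s (Suc k)"
      by (simp only: s)
    finally show ?thesis
      using s(1)[of "Suc k"] by (simp add: \<theta>_def field_simps)
  qed
  obtain k where "C / \<delta> < 4 ^ k"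
    using real_arch_pow[of 4 "C / \<delta>"] by auto
  then have "C < 4 ^ k * \<delta>"
    using \<delta> by (simp add: field_simps)
  also have "4 ^ k * \<delta> \<le> 4 ^ Suc (Suc k) * \<delta>"
    using \<delta> by simp
  also have "\<dots> \<le> \<theta> (Suc (Suc k)) - 1"
    using growth[of "Suc (Suc k)"] by simp
  also have "\<dots> \<le> C / 2"
    using upper[of "Suc k"] by simp
  finally have "C < 0" by simp
  moreover have "C \<ge> 0"
    unfolding C_def by (intro add_nonneg_nonneg mult_nonneg_nonneg of_nat_0_le_iff) auto
  ultimately show False
    by simp
qed

end

section \<open>Kloosterman sums modulo a prime\<close>

definition expi :: "nat \<Rightarrow> nat \<Rightarrow> complex" where
  "expi p n = cis (2 * pi * real n / real p)"

lemma expi_add: "expi p (m + n) = expi p m * expi p n"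
  by (simp add: expi_def cis_mult ring_distribs add_divide_distrib)

lemma expi_multiple: "p > 0 \<Longrightarrow> expi p (p * n) = 1"
  using cis_multiple_2pi[of "real n"] by (simp add: expi_def mult.assoc)

lemma expi_mod: "p > 0 \<Longrightarrow> expi p (n mod p) = expi p n"
  using expi_add[of p "p * (n div p)" "n mod p"] expi_multiple[of p "n div p"] by simp

lemma norm_expi [simp]: "norm (expi p n) = 1"
  by (simp add: expi_def)

lemma expi_power: "expi p n ^ k = expi p (k * n)"
  by (induction k) (simp_all add: expi_add, simp add: expi_def)

lemma expi_eq_1_iff:
  assumes "p > 0"
  shows "expi p n = 1 \<longleftrightarrow> p dvd n"
proof
  assume "expi p n = 1"
  then have "sin (2 * pi * real n / real p) = 0" "cos (2 * pi * real n / real p) = 1"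
    by (simp_all add: expi_def complex_eq_iff)
  then obtain k :: int where "2 * pi * real n / real p = k * (2 * pi)"
    using cos_one_2pi_int by auto
  then have "real n = k * real p"
    using assms by (simp add: field_simps)
  then have "int n = k * int p"
    by (metis of_int_eq_iff of_int_mult of_int_of_nat_eq)
  then show "p dvd n"
    by (metis dvd_triv_right int_dvd_int_iff)
qed (use assms expi_multiple in auto)

definition modinv :: "nat \<Rightarrow> nat \<Rightarrow> nat" where
  "modinv p x = nat (modular_inverse (int p) (int x))"

lemma modinv:
  assumes "prime p" "x \<in> {1..<p}"
  shows "modinv p x \<in> {1..<p}" "[x * modinv p x = 1] (mod p)"
proof -
  have p: "p > 1"
    using assms(1) prime_gt_1_nat by blast
  have "coprime x p"
    using assms by (auto simp: coprime_commute[of x] intro!: prime_imp_coprime dest: dvd_imp_le)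
  then have "coprime (int x) (int p)"
    by simp
  then have inv: "[int x * modular_inverse (int p) (int x) = 1] (mod int p)"
    by (rule cong_modular_inverse1)
  have nonneg: "modular_inverse (int p) (int x) \<in> {0..<int p}"
    using p by (simp add: modular_inverse_int_nonneg modular_inverse_int_less)
  then have nat: "int (modinv p x) = modular_inverse (int p) (int x)"
    by (simp add: modinv_def)
  show *: "[x * modinv p x = 1] (mod p)"
    using inv by (simp flip: nat add: cong_int_iff [symmetric])
  have "modinv p x < p"
    using nonneg nat by auto
  moreover have "modinv p x \<noteq> 0"
    using * p by (intro notI) (simp add: cong_def)
  ultimately show "modinv p x \<in> {1..<p}"
    by simp
qed

definition mod_character :: "nat \<Rightarrow> (nat \<Rightarrow> complex) \<Rightarrow> bool" where
  "mod_character p \<eta> \<longleftrightarrow>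
     (\<forall>x y. \<not> p dvd x \<longrightarrow> \<not> p dvd y \<longrightarrow> \<eta> (x * y) = \<eta> x * \<eta> y) \<and>
     (\<forall>x. \<eta> (x mod p) = \<eta> x) \<and>
     (\<forall>x. \<not> p dvd x \<longrightarrow> norm (\<eta> x) = 1)"

definition kloosterman_sum :: "nat \<Rightarrow> (nat \<Rightarrow> complex) \<Rightarrow> nat \<Rightarrow> nat \<Rightarrow> complex" where
  "kloosterman_sum p \<eta> k l = (\<Sum>x = 1..<p. \<eta> x * expi p (k * x + l * modinv p x))"

definition weil_bound_holds :: "nat \<Rightarrow> bool" where
  "weil_bound_holds p \<longleftrightarrow> (\<forall>\<eta> k l. mod_character p \<eta> \<longrightarrow> \<not> p dvd k \<longrightarrow> \<not> p dvd l \<longrightarrow>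
     norm (kloosterman_sum p \<eta> k l) \<le> 2 * sqrt (real p))"

lemma bij_betw_of_nat_GF:
  "bij_betw of_nat {..<CHAR('a)} (GF 1 :: 'a :: {alg_closed_field, field_prime_char} set)"
proof -
  have "inj_on (of_nat :: nat \<Rightarrow> 'a) {..<CHAR('a)}"
    by (intro inj_onI) (auto simp: of_nat_eq_iff_cong_CHAR cong_def)
  moreover have "of_nat n \<in> (GF 1 :: 'a set)" for n
    by (induction n) (auto intro: GF_add)
  then have "of_nat ` {..<CHAR('a)} \<subseteq> (GF 1 :: 'a set)"
    by auto
  moreover have "card (GF 1 :: 'a set) = CHAR('a)" "finite (GF 1 :: 'a set)"
    using finite_card_GF[of 1, where ?'a = 'a] by auto
  ultimately show ?thesis
    unfolding bij_betw_def by (metis card_image card_lessThan card_subset_eq)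
qed

text \<open>
  The natural numbers below \<open>p\<close> represent the prime field, and characters modulo \<open>p\<close> become characters of it.
\<close>

lemma weil_bound_of_field:
  assumes p: "CHAR('a :: {alg_closed_field, field_prime_char}) > 2"
  shows "weil_bound_holds CHAR('a)"
  unfolding weil_bound_holds_def
proof (intro allI impI)
  define p where "p = CHAR('a)"
  fix \<eta> k l assume \<eta>: "mod_character CHAR('a) \<eta>" and kl: "\<not> CHAR('a) dvd k" "\<not> CHAR('a) dvd l"
  define idx :: "'a \<Rightarrow> nat" where "idx = the_inv_into {..<p} of_nat"
  have p0: "p > 0" and pp: "prime p"
    by (simp_all add: p_def)
  have bij: "bij_betw of_nat {..<p} (GF 1 :: 'a set)"
    unfolding p_def by (rule bij_betw_of_nat_GF)
  have idx_less: "idx (of_nat n) = n mod p" for n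
  proof -
    have "of_nat n = (of_nat (n mod p) :: 'a)"
      by (simp add: of_nat_eq_iff_cong_CHAR p_def cong_def)
    then show ?thesis
      using the_inv_into_f_f[of "of_nat :: nat \<Rightarrow> 'a" "{..<p}" "n mod p"] bij p0 by (simp add: idx_def bij_betw_def)
  qed
  have of_idx: "of_nat (idx x) = x" if "x \<in> GF 1" for x
    unfolding idx_def using bij that by (intro f_the_inv_into_f) (auto simp: bij_betw_def)
  have idx_dvd: "p dvd idx x \<longleftrightarrow> x = 0" if "x \<in> GF 1" for x
    using of_nat_eq_0_iff_char_dvd[of "idx x", where ?'a = 'a] of_idx[OF that] by (simp add: p_def)
  have idx_mult: "idx (x * y) = (idx x * idx y) mod p" and idx_add: "idx (x + y) = (idx x + idx y) mod p"
    if "x \<in> GF 1" "y \<in> GF 1" for x y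
    using idx_less[of "idx x * idx y"] idx_less[of "idx x + idx y"] of_idx[OF that(1)] of_idx[OF that(2)]
    by simp_all
  interpret finite_field_characters "\<lambda>x :: 'a. \<eta> (idx x)" "\<lambda>x :: 'a. expi p (idx x)"
  proof
    show "\<eta> (idx (x * y)) = \<eta> (idx x) * \<eta> (idx y)" if "x \<in> GF 1 - {0}" "y \<in> GF 1 - {0}" for x y
      using \<eta> that idx_dvd idx_mult by (simp add: mod_character_def flip: p_def)
    show "norm (\<eta> (idx x)) = 1" if "x \<in> GF 1 - {0}" for x
      using \<eta> that idx_dvd by (simp add: mod_character_def flip: p_def)
    show "expi p (idx (x + y)) = expi p (idx x) * expi p (idx y)" if "x \<in> GF 1" "y \<in> GF 1" for x y
      using idx_add[OF that] p0 by (simp add: expi_mod expi_add)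
    show "\<exists>x\<in>GF 1. expi p (idx x) \<noteq> 1"
      using idx_less[of 1] p by (intro bexI[of _ 1]) (auto simp: expi_eq_1_iff p_def)
  qed simp
  have nz: "of_nat k \<in> GF 1 - {0 :: 'a}" "of_nat l \<in> GF 1 - {0 :: 'a}"
  proof -
    have "of_nat n \<in> (GF 1 :: 'a set)" for n
      by (induction n) (auto intro: GF_add)
    then show "of_nat k \<in> GF 1 - {0 :: 'a}" "of_nat l \<in> GF 1 - {0 :: 'a}"
      using kl by (auto simp: of_nat_eq_0_iff_char_dvd)
  qed
  have bij0: "bij_betw of_nat {1..<p} (GF 1 - {0 :: 'a})"
  proof -
    have "bij_betw of_nat ({..<p} - {0}) (GF 1 - {0 :: 'a})"
      using bij_betw_DiffI[OF bij, of "{0}" "{0}"] p0 by simp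
    also have "{..<p} - {0} = {1..<p}"
      by auto
    finally show ?thesis .
  qed
  have "kloosterman 1 (of_nat k) (of_nat l) =
     (\<Sum>x\<in>GF 1 - {0 :: 'a}. \<eta> (idx x) * expi p (idx (of_nat k * x + of_nat l / x)))"
    by (simp add: kloosterman_def)
  also have "\<dots> = (\<Sum>x = 1..<p. \<eta> (idx (of_nat x :: 'a)) * expi p (idx (of_nat k * of_nat x + of_nat l / of_nat x :: 'a)))"
    by (rule sum.reindex_bij_betw [OF bij0, symmetric])
  also have "\<dots> = kloosterman_sum p \<eta> k l"
    unfolding kloosterman_sum_def
  proof (intro sum.cong refl)
    fix x assume x: "x \<in> {1..<p}"
    have "of_nat (x * modinv p x) = (1 :: 'a)"
      using modinv(2)[OF pp x] of_nat_eq_iff_cong_CHAR[of "x * modinv p x" 1, where ?'a = 'a]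
      by (simp add: p_def)
    then have "1 / of_nat x = (of_nat (modinv p x) :: 'a)"
      by (metis div_by_0 nonzero_mult_div_cancel_left of_nat_mult mult_zero_left zero_neq_one)
    then have "of_nat k * of_nat x + of_nat l / of_nat x = (of_nat (k * x + l * modinv p x) :: 'a)"
      by (metis of_nat_add of_nat_mult mult.right_neutral times_divide_eq_right)
    then show "\<eta> (idx (of_nat x :: 'a)) * expi p (idx (of_nat k * of_nat x + of_nat l / of_nat x :: 'a)) =
        \<eta> x * expi p (k * x + l * modinv p x)"
      using \<eta> p0 by (simp only: idx_less expi_mod) (simp add: mod_character_def p_def)
  qed
  finally show "norm (kloosterman_sum CHAR('a) \<eta> k l) \<le> 2 * sqrt (real CHAR('a))"
    using weil_bound[OF p nz] by (simp add: p_def)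
qed

text \<open>
  It remains to provide, for each prime \<open>p\<close>, a type that is an algebraically closed field of characteristic
  \<open>p\<close>. Types cannot depend on the variable \<open>p\<close>, but they can depend on a constant. By the drinker
  principle there is a fixed prime \<open>p\<close> such that the bound holds for all odd primes if it holds for \<open>p\<close>: a
  counterexample if there is one, and an arbitrary odd prime otherwise. A type for this prime is enough.
\<close>

definition decisive_prime :: nat where
  "decisive_prime = (SOME p. prime p \<and> p > 2 \<and>
     (weil_bound_holds p \<longrightarrow> (\<forall>q. prime q \<longrightarrow> q > 2 \<longrightarrow> weil_bound_holds q)))"

lemma decisive_prime:
  "prime decisive_prime" "decisive_prime > 2"
  "weil_bound_holds decisive_prime \<Longrightarrow> prime q \<Longrightarrow> q > 2 \<Longrightarrow> weil_bound_holds q"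
proof -
  have "\<exists>p. prime p \<and> p > 2 \<and> (weil_bound_holds p \<longrightarrow> (\<forall>q. prime q \<longrightarrow> q > 2 \<longrightarrow> weil_bound_holds q))"
  proof (cases "\<exists>p. prime p \<and> p > 2 \<and> \<not> weil_bound_holds p")
    case False
    then show ?thesis
      by (intro exI[of _ 3]) auto
  qed auto
  from someI_ex[OF this] show "prime decisive_prime" "decisive_prime > 2"
    "weil_bound_holds decisive_prime \<Longrightarrow> prime q \<Longrightarrow> q > 2 \<Longrightarrow> weil_bound_holds q"
    unfolding decisive_prime_def [symmetric] by auto
qed

typedef decisive_residues = "{..<decisive_prime}"
  using decisive_prime(2) by (intro exI[of _ 0]) simp

instance decisive_residues :: prime_card
proof
  interpret type_definition Rep_decisive_residues Abs_decisive_residues "{..<decisive_prime}"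
    by (rule type_definition_decisive_residues)
  show "prime CARD(decisive_residues)"
    by (simp add: card decisive_prime)
qed

lemma CARD_decisive_residues: "CARD(decisive_residues) = decisive_prime"
proof -
  interpret type_definition Rep_decisive_residues Abs_decisive_residues "{..<decisive_prime}"
    by (rule type_definition_decisive_residues)
  show ?thesis
    by (simp add: card)
qed

instance alg_closure :: (field_prime_char) field_prime_char
  by standard (simp add: CHAR_pos)

theorem kloosterman_sum_bound:
  assumes "prime p" "p > 2" "mod_character p \<eta>" "\<not> p dvd k" "\<not> p dvd l"
  shows "norm (kloosterman_sum p \<eta> k l) \<le> 2 * sqrt (real p)"
proof -
  have "CHAR(decisive_residues mod_ring alg_closure) = decisive_prime"
    by (simp add: CARD_decisive_residues)
  then have "weil_bound_holds decisive_prime"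
    using weil_bound_of_field[where ?'a = "decisive_residues mod_ring alg_closure"] decisive_prime(2) by simp
  then show ?thesis
    using decisive_prime(3) assms unfolding weil_bound_holds_def by blast
qed

lemma sum_expi:
  assumes "p > 0"
  shows "(\<Sum>k<p. expi p (k * n)) = (if p dvd n then of_nat p else 0)"
proof (cases "p dvd n")
  case True
  then show ?thesis
    using assms by (simp add: expi_eq_1_iff[THEN iffD2])
next
  case False
  then have "expi p n \<noteq> 1"
    using assms by (simp add: expi_eq_1_iff)
  then have "(\<Sum>k<p. expi p n ^ k) = (expi p n ^ p - 1) / (expi p n - 1)"
    by (rule geometric_sum)
  also have "expi p n ^ p = 1"
    using assms by (simp add: expi_power expi_multiple)
  finally show ?thesis
    using False by (simp add: expi_power)
qed

section \<open>The Fourier expansion of parity\<close>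

text \<open>
  The Fourier coefficients modulo \<open>p\<close> of the function that is \<open>(-1)^v\<close> for \<open>0 < v < p\<close> and 0 for \<open>v = 0\<close>. With
  this value at 0 the zeroth coefficient vanishes, so that only nondegenerate Kloosterman sums occur
  below.
\<close>

definition sign_coeff :: "nat \<Rightarrow> nat \<Rightarrow> complex" where
  "sign_coeff p k = (\<Sum>v = 1..<p. (-1) ^ v * expi p (k * v))"

text \<open>
  Orthogonality picks out the term \<open>v = p - x\<close>. As \<open>p\<close> is odd, \<open>p - x\<close> and \<open>x\<close> have opposite
  parities, hence the minus sign.
\<close>

lemma sign_expansion:
  assumes "odd p" "x \<in> {1..<p}"
  shows "(-1) ^ x = - (\<Sum>k<p. sign_coeff p k * expi p (k * x)) / of_nat p"
proof -
  have "(\<Sum>k<p. sign_coeff p k * expi p (k * x)) = (\<Sum>k<p. \<Sum>v = 1..<p. (-1) ^ v * expi p (k * (v + x)))"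
    by (simp add: sign_coeff_def sum_distrib_right expi_add ring_distribs mult.assoc)
  also have "\<dots> = (\<Sum>v = 1..<p. (-1) ^ v * (\<Sum>k<p. expi p (k * (v + x))))"
    by (subst sum.swap) (simp add: sum_distrib_left)
  also have "\<dots> = (\<Sum>v = 1..<p. if v = p - x then (-1) ^ v * of_nat p else 0)"
  proof (intro sum.cong refl)
    fix v assume v: "v \<in> {1..<p}"
    have "p dvd v + x \<longleftrightarrow> v = p - x"
    proof
      assume "p dvd v + x"
      then obtain c where c: "v + x = p * c" by blast
      then have "p * c < p * 2" "p * c > p * 0"
        using v assms by (auto simp: c [symmetric])
      then have "c = 1"
        by (metis One_nat_def less_2_cases mult_less_cancel1 neq0_conv)
      with c v assms show "v = p - x" by auto
    qed (use v assms in auto)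
    then show "(-1) ^ v * (\<Sum>k<p. expi p (k * (v + x))) = (if v = p - x then (-1) ^ v * of_nat p else 0 :: complex)"
      using assms by (subst sum_expi) auto
  qed
  also have "\<dots> = (-1) ^ (p - x) * of_nat p"
    using assms by (subst sum.delta) auto
  also have "(-1 :: complex) ^ (p - x) = - ((-1) ^ x)"
    using assms by (simp add: minus_one_power_iff even_diff_nat) 
  finally show ?thesis
    using assms by (auto simp: odd_pos)
qed

lemma cos_pi_frac_nonzero:
  assumes "odd p"
  shows "cos (pi * real k / real p) \<noteq> 0"
proof
  assume "cos (pi * real k / real p) = 0"
  then obtain i :: int where i: "odd i" "pi * real k / real p = i * (pi / 2)"
    using cos_zero_iff_int by blast
  have "p > 0"
    using assms by (rule odd_pos)
  then have "2 * real k = i * real p"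
    using i(2) by (simp add: field_simps)
  then have "2 * int k = i * int p"
    by (metis of_int_eq_iff of_int_mult of_int_numeral of_int_of_nat_eq)
  then have "even (i * int p)"
    by (metis dvd_triv_left)
  with i(1) assms show False
    by simp
qed

text \<open>
  For \<open>\<theta> = \<pi> k / p\<close> the coefficient is a geometric sum with ratio \<open>y = - cis (2 \<theta>)\<close>. Since \<open>p\<close> is odd,
  \<open>y^p = -1\<close>, and the sum equals \<open>(1 + y) / (1 - y) = - \<i> tan \<theta>\<close>.
\<close>

lemma norm_sign_coeff:
  assumes "odd p"
  shows "norm (sign_coeff p k) = \<bar>tan (pi * real k / real p)\<bar>"
proof -
  define \<theta> where "\<theta> = pi * real k / real p"
  define y where "y = - expi p k"
  have p: "p > 0"
    using assms by (rule odd_pos)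
  have double: "cis (2 * \<theta>) = cis \<theta> * cis \<theta>" and y: "y = - (cis \<theta> * cis \<theta>)"
    by (simp_all add: y_def expi_def \<theta>_def cis_mult mult.assoc)
  have sc: "sin \<theta> * sin \<theta> = 1 - cos \<theta> * cos \<theta>"
    using sin_squared_eq[of \<theta>] by (simp add: power2_eq_square)
  have "y ^ p = - 1"
    using assms p by (simp add: y_def expi_power expi_multiple power_minus_odd)
  have "sign_coeff p k = (\<Sum>v = 1..<p. y ^ v)"
    by (simp add: sign_coeff_def y_def expi_power power_minus[of "expi p k"] mult.commute)
  then have "(1 - y) * sign_coeff p k = (\<Sum>v = 1..<p. y ^ v - y ^ Suc v)"
    by (simp add: sum_distrib_left algebra_simps)
  also have "\<dots> = - (\<Sum>v = 1..<p. y ^ Suc v - y ^ v)"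
    by (simp add: sum_negf [symmetric])
  also have "(\<Sum>v = 1..<p. y ^ Suc v - y ^ v) = y ^ p - y ^ 1"
    using p by (intro sum_Suc_diff') simp
  finally have "(1 - y) * sign_coeff p k = 1 + y"
    using \<open>y ^ p = - 1\<close> by simp
  moreover have "1 - y = cis \<theta> * of_real (2 * cos \<theta>)"
    by (simp add: y complex_eq_iff sc algebra_simps)
  moreover have "1 + y = cis \<theta> * (- \<i> * of_real (2 * sin \<theta>))"
    by (simp add: y complex_eq_iff algebra_simps)
  ultimately have "cis \<theta> * of_real (2 * cos \<theta>) * sign_coeff p k = cis \<theta> * (- \<i> * of_real (2 * sin \<theta>))"
    by simp
  then have "norm (cis \<theta> * of_real (2 * cos \<theta>) * sign_coeff p k) = norm (cis \<theta> * (- \<i> * of_real (2 * sin \<theta>)))"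
    by (rule arg_cong)
  then have "\<bar>cos \<theta>\<bar> * norm (sign_coeff p k) = \<bar>sin \<theta>\<bar>"
    by (simp add: norm_mult abs_mult)
  then show ?thesis
    using cos_pi_frac_nonzero[OF assms, of k] by (simp add: tan_def \<theta>_def abs_divide field_simps)
qed

lemma sum_norm_sign_coeff:
  assumes "odd p" "p > 1"
  shows "(\<Sum>k<p. norm (sign_coeff p k)) = T p * real p * ln (real p)"
proof -
  define h where "h = (p - 1) div 2"
  have p: "p = 2 * h + 1"
    using assms by (auto simp: h_def elim: oddE)
  let ?t = "\<lambda>k. \<bar>tan (pi * real k / real p)\<bar>"
  have "(\<Sum>k<p. norm (sign_coeff p k)) = (\<Sum>k<p. ?t k)"
    by (simp add: norm_sign_coeff assms)
  also have "\<dots> = (\<Sum>k = 1..h. ?t k) + (\<Sum>k = h + 1..2 * h. ?t k)"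
  proof -
    have "{..<p} = insert 0 ({1..h} \<union> {h + 1..2 * h})"
      by (auto simp: p)
    then show ?thesis
      by (simp add: sum.union_disjoint)
  qed
  also have "(\<Sum>k = h + 1..2 * h. ?t k) = (\<Sum>k = 1..h. ?t k)"
  proof (rule sum.reindex_bij_witness[of _ "\<lambda>k. p - k" "\<lambda>k. p - k"])
    fix k assume "k \<in> {h + 1..2 * h}"
    then have "pi * real (p - k) / real p = pi - pi * real k / real p"
      by (auto simp: p of_nat_diff field_simps)
    then show "?t (p - k) = ?t k"
      by (simp add: tan_def)
  qed (auto simp: p)
  also have "(\<Sum>k = 1..h. ?t k) = (\<Sum>k = 1..h. tan (pi * real k / real p))"
  proof (intro sum.cong refl abs_of_nonneg)
    fix k assume "k \<in> {1..h}"
    then have k: "real k > 0" "real k / real p < 1 / 2"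
      by (auto simp: p field_simps)
    then have "0 < pi * real k / real p" "pi * real k / real p < pi / 2"
      using mult_strict_left_mono[OF k(2) pi_gt_zero] by (auto simp: p)
    then show "0 \<le> tan (pi * real k / real p)"
      by (simp add: tan_gt_zero less_imp_le)
  qed
  finally show ?thesis
    using assms by (simp add: T_def h_def)
qed

definition inverse_sign :: "nat \<Rightarrow> nat \<Rightarrow> complex" where
  "inverse_sign p x = (-1) ^ (x + modinv p x)"

text \<open>
  Expanding \<open>(-1)^x\<close> and \<open>(-1)^(modinv p x)\<close> separately gives a weighted double sum of Kloosterman sums.
\<close>

lemma sign_character_sum_bound:
  assumes p: "prime p" "p > 2" and \<eta>: "mod_character p \<eta>"
  shows "norm (\<Sum>x = 1..<p. \<eta> x * inverse_sign p x) \<le> 2 * sqrt (real p) * (T p)\<^sup>2 * (ln (real p))\<^sup>2"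
proof -
  let ?c = "sign_coeff p"
  have odd: "odd p" and p0: "p > 0"
    using p prime_odd_nat by auto
  have "?c 0 = 0"
    using norm_sign_coeff[OF odd, of 0] by simp
  have "\<eta> x * inverse_sign p x = (\<Sum>k<p. \<Sum>l<p. ?c k * ?c l * (\<eta> x * expi p (k * x + l * modinv p x))) / of_nat p ^ 2"
    if "x \<in> {1..<p}" for x
  proof -
    let ?A = "\<Sum>k<p. ?c k * expi p (k * x)" and ?B = "\<Sum>l<p. ?c l * expi p (l * modinv p x)"
    have "\<eta> x * inverse_sign p x = \<eta> x * ((- ?A / of_nat p) * (- ?B / of_nat p))"
      unfolding inverse_sign_def power_add
        sign_expansion[OF odd that] sign_expansion[OF odd modinv(1)[OF p(1) that]] ..
    also have "\<dots> = \<eta> x * (?A * ?B) / of_nat p ^ 2"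
      by (simp add: power2_eq_square)
    also have "\<eta> x * (?A * ?B) = (\<Sum>k<p. \<Sum>l<p. ?c k * ?c l * (\<eta> x * expi p (k * x + l * modinv p x)))"
      unfolding sum_product by (simp only: sum_distrib_left expi_add mult_ac)
    finally show ?thesis .
  qed
  then have "(\<Sum>x = 1..<p. \<eta> x * inverse_sign p x) =
      (\<Sum>x = 1..<p. (\<Sum>k<p. \<Sum>l<p. ?c k * ?c l * (\<eta> x * expi p (k * x + l * modinv p x))) / of_nat p ^ 2)"
    by simp
  also have "\<dots> = (\<Sum>k<p. \<Sum>l<p. ?c k * ?c l * kloosterman_sum p \<eta> k l) / of_nat p ^ 2"
    unfolding kloosterman_sum_def sum_distrib_left sum_divide_distrib [symmetric]
    by (subst sum.swap, subst (2) sum.swap) simp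
  finally have "norm (\<Sum>x = 1..<p. \<eta> x * inverse_sign p x) =
     norm (\<Sum>k<p. \<Sum>l<p. ?c k * ?c l * kloosterman_sum p \<eta> k l) / real p ^ 2"
    by (simp add: norm_divide norm_power)
  also have "norm (\<Sum>k<p. \<Sum>l<p. ?c k * ?c l * kloosterman_sum p \<eta> k l) \<le>
      (\<Sum>k<p. \<Sum>l<p. norm (?c k) * norm (?c l) * (2 * sqrt (real p)))"
  proof (intro sum_norm_le)
    fix k l assume kl: "k \<in> {..<p}" "l \<in> {..<p}"
    show "norm (?c k * ?c l * kloosterman_sum p \<eta> k l) \<le> norm (?c k) * norm (?c l) * (2 * sqrt (real p))"
    proof (cases "k = 0 \<or> l = 0")
      case True
      then show ?thesis
        using \<open>?c 0 = 0\<close> by auto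
    next
      case False
      then have "\<not> p dvd k" "\<not> p dvd l"
        using kl by (auto dest: dvd_imp_le)
      then show ?thesis
        unfolding norm_mult using kloosterman_sum_bound[OF p \<eta>] by (intro mult_left_mono) auto
    qed
  qed
  also have "\<dots> = (\<Sum>k<p. norm (?c k)) ^ 2 * (2 * sqrt (real p))"
    unfolding power2_eq_square sum_product by (simp only: sum_distrib_right)
  also have "\<dots> / real p ^ 2 = 2 * sqrt (real p) * (T p)\<^sup>2 * (ln (real p))\<^sup>2"
    unfolding sum_norm_sign_coeff[OF odd prime_gt_1_nat[OF p(1)]] using p0
    by (simp add: power_mult_distrib)
  finally show ?thesis
    by (simp add: divide_right_mono)
qed

section \<open>Sieving for primitive roots\<close>

lemma not_dvd_indicator:
  assumes "l > 0"
  shows "(if l dvd n then 0 else 1 :: complex) = of_real (1 - 1 / real l) - (\<Sum>h = 1..<l. expi l (h * n)) / of_nat l"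
proof -
  have "(\<Sum>h<l. expi l (h * n)) = 1 + (\<Sum>h = 1..<l. expi l (h * n))"
    using assms by (simp add: lessThan_atLeast0 sum.atLeast_Suc_lessThan expi_def)
  then have "(\<Sum>h = 1..<l. expi l (h * n)) = (if l dvd n then of_nat l else 0) - 1"
    using sum_expi[OF assms, of n] by simp
  then show ?thesis
    using assms by (simp add: diff_divide_distrib)
qed

text \<open>
  Induction on the set of primes, for all characters \<open>h\<close> simultaneously: by \<open>not_dvd_indicator\<close> a further
  prime \<open>l\<close> replaces the sum by a combination of \<open>l\<close> sums of the same kind with other \<open>h\<close>, whose
  coefficients have absolute values \<open>1 - 1 / l\<close> (once) and \<open>1 / l\<close> (\<open>l - 1\<close> times).
\<close>

lemma character_sieve:
  fixes f :: "nat \<Rightarrow> complex"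
  assumes m: "m > 0" and fin: "finite L" and L: "\<And>l. l \<in> L \<Longrightarrow> l > 0 \<and> l dvd m"
    and B: "\<And>h. norm (\<Sum>i<m. expi m (h * i) * f i) \<le> B"
  shows "norm (\<Sum>i<m. expi m (h * i) * (\<Prod>l\<in>L. if l dvd i then 0 else 1) * f i)
           \<le> (\<Prod>l\<in>L. 2 * (1 - 1 / real l)) * B"
  using fin L
proof (induction L arbitrary: h rule: finite_induct)
  case empty
  then show ?case
    using B by simp
next
  case (insert l L)
  define P where "P i = (\<Prod>l\<in>L. if l dvd i then 0 else 1 :: complex)" for i :: nat
  define R where "R = (\<Prod>l\<in>L. 2 * (1 - 1 / real l)) * B"
  have IH: "norm (\<Sum>i<m. expi m (h * i) * P i * f i) \<le> R" for h
    unfolding P_def R_def using insert by blast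
  have l: "l > 0" and lm: "l * (m div l) = m"
    using insert.prems[of l] by auto
  have expi_l: "expi l n = expi m (m div l * n)" for n
  proof -
    define d where "d = m div l"
    have "m = l * d"
      using lm by (simp add: d_def)
    then have "d \<noteq> 0"
      using m by (intro notI) simp
    with \<open>m = l * d\<close> have "2 * pi * real n / real l = 2 * pi * real (d * n) / real m"
      by simp
    then show ?thesis
      by (simp add: expi_def d_def)
  qed
  have "(\<Sum>i<m. expi m (h * i) * (\<Prod>l\<in>insert l L. if l dvd i then 0 else 1) * f i) =
     (\<Sum>i<m. expi m (h * i) * P i * f i * (if l dvd i then 0 else 1))"
    using insert.hyps by (intro sum.cong refl) (simp add: P_def)
  also have "\<dots> = (\<Sum>i<m. expi m (h * i) * P i * f i * of_real (1 - 1 / real l) -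
     (\<Sum>k = 1..<l. expi m ((h + m div l * k) * i) * P i * f i) / of_nat l)"
    unfolding not_dvd_indicator[OF l]
    by (intro sum.cong refl) (simp add: expi_l expi_add algebra_simps sum_distrib_left sum_divide_distrib)
  also have "\<dots> = of_real (1 - 1 / real l) * (\<Sum>i<m. expi m (h * i) * P i * f i) -
     (\<Sum>k = 1..<l. \<Sum>i<m. expi m ((h + m div l * k) * i) * P i * f i) / of_nat l"
  proof -
    have "(\<Sum>k = 1..<l. \<Sum>i<m. expi m ((h + m div l * k) * i) * P i * f i) =
        (\<Sum>i<m. \<Sum>k = 1..<l. expi m ((h + m div l * k) * i) * P i * f i)"
      by (rule sum.swap)
    then show ?thesis
      by (simp only: sum_subtractf sum_divide_distrib [symmetric] sum_distrib_right [symmetric] mult.commute [of "of_real _"])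
  qed
  also have "norm \<dots> \<le> (1 - 1 / real l) * R + (real l - 1) * R / real l"
  proof (rule order_trans[OF norm_triangle_ineq4 add_mono])
    show "norm (of_real (1 - 1 / real l) * (\<Sum>i<m. expi m (h * i) * P i * f i)) \<le> (1 - 1 / real l) * R"
      using l IH[of h] unfolding norm_mult norm_of_real by (intro mult_mono) auto
    have "norm (\<Sum>k = 1..<l. \<Sum>i<m. expi m ((h + m div l * k) * i) * P i * f i) \<le> (\<Sum>k = 1..<l. R)"
      by (intro sum_norm_le IH)
    also have "\<dots> = (real l - 1) * R"
      using l by (simp add: of_nat_diff Suc_le_eq)
    finally show "norm ((\<Sum>k = 1..<l. \<Sum>i<m. expi m ((h + m div l * k) * i) * P i * f i) / of_nat l)
        \<le> (real l - 1) * R / real l"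
      by (simp add: norm_divide divide_right_mono)
  qed
  also have "\<dots> = (2 * (1 - 1 / real l)) * R"
    using l by (simp add: field_simps)
  finally show ?case
    using insert.hyps by (simp add: R_def mult.assoc)
qed

text \<open>
  The characters modulo \<open>p\<close> are the functions that the exponentials become when every residue is written
  as a power of the primitive root \<open>g\<close>.
\<close>

lemma power_characters:
  assumes p: "prime p" and g: "residue_primroot p g"
  obtains \<eta> where "mod_character p \<eta>" "\<And>i. \<eta> (g ^ i mod p) = expi (p - 1) (h * i)"
proof -
  have p1: "p > 1"
    using p prime_gt_1_nat by blast
  have ord: "ord p g = p - 1" and cop: "coprime p g"
    using g p by (auto simp: residue_primroot_def totient_prime)
  have bij: "bij_betw (\<lambda>i. g ^ i mod p) {..<p - 1} {0<..<p}"
    using residue_primroot_is_generator[OF p1 g] p by (simp add: totient_prime totatives_prime)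
  define ind where "ind x = (SOME i. [g ^ i = x] (mod p))" for x
  have ex: "\<exists>i. [g ^ i = x] (mod p)" if "\<not> p dvd x" for x
  proof -
    have "x mod p \<in> {0<..<p}"
      using that p1 by (auto simp: mod_eq_0_iff_dvd intro!: Nat.gr0I)
    then have "x mod p \<in> (\<lambda>i. g ^ i mod p) ` {..<p - 1}"
      by (simp only: bij_betw_imp_surj_on[OF bij])
    then obtain i where "x mod p = g ^ i mod p"
      by (rule imageE)
    then show ?thesis
      by (intro exI[of _ i]) (simp add: cong_def)
  qed
  have ind: "[g ^ ind x = x] (mod p)" if "\<not> p dvd x" for x
    unfolding ind_def by (rule someI_ex[OF ex[OF that]])
  have expi_cong: "expi (p - 1) (h * i) = expi (p - 1) (h * j)" if "[g ^ i = g ^ j] (mod p)" for i j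
  proof -
    have "[i = j] (mod (p - 1))"
      using that order_divides_expdiff[OF cop, of i j] by (simp add: ord)
    then have "[h * i = h * j] (mod (p - 1))"
      by (rule cong_scalar_left)
    then show ?thesis
      using p1 by (metis cong_def expi_mod zero_less_diff)
  qed
  define \<eta> where "\<eta> x = expi (p - 1) (h * ind (x mod p))" for x
  show thesis
  proof
    show "mod_character p \<eta>"
      unfolding mod_character_def
    proof (intro conjI allI impI)
      fix x y assume xy: "\<not> p dvd x" "\<not> p dvd y"
      then have nd: "\<not> p dvd x mod p" "\<not> p dvd y mod p" "\<not> p dvd (x * y) mod p"
        using p by (auto simp: dvd_mod_iff prime_dvd_mult_iff)
      have "[g ^ ind ((x * y) mod p) = x * y] (mod p)"
        using ind[OF nd(3)] by (simp add: cong_def)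
      also have "[x * y = g ^ ind (x mod p) * g ^ ind (y mod p)] (mod p)"
        using ind[OF nd(1)] ind[OF nd(2)] by (intro cong_mult) (simp_all add: cong_def)
      finally have "[g ^ ind ((x * y) mod p) = g ^ (ind (x mod p) + ind (y mod p))] (mod p)"
        by (simp add: power_add)
      from expi_cong[OF this] show "\<eta> (x * y) = \<eta> x * \<eta> y"
        by (simp add: \<eta>_def distrib_left expi_add)
    qed (simp_all add: \<eta>_def)
    fix i
    have "\<not> p dvd g ^ i mod p"
      using cop p p1 by (simp add: dvd_mod_iff) (metis coprime_absorb_left coprime_power_right_iff
          nat_dvd_1_iff_1 not_prime_1 prime_dvd_power)
    from ind[OF this] have "[g ^ ind (g ^ i mod p) = g ^ i] (mod p)"
      by (simp add: cong_def)
    from expi_cong[OF this] show "\<eta> (g ^ i mod p) = expi (p - 1) (h * i)"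
      by (simp add: \<eta>_def)
  qed
qed

lemma lehmer_number_modinv:
  assumes "prime p" "a \<in> {1..<p}"
  shows "lehmer_number p a \<longleftrightarrow> odd (a + modinv p a)"
  using assms modinv[OF assms] prime_gt_1_nat[OF assms(1)] by (intro lehmer_number_iff) auto

text \<open>
  If every primitive root \<open>x\<close> had the parity of its inverse, the sign would be 1 on all primitive roots, and
  the sieved sum would be \<open>\<phi>(p - 1)\<close>. The sieve bounds it by \<open>\<phi>(p - 1) / (p - 1)\<close> times the
  left-hand side of the hypothesis.
\<close>

theorem lehmer_primroot_exists:
  assumes p: "prime p" "p > 3"
    and bound: "2 * sqrt (real p) * (T p)\<^sup>2 * (ln (real p))\<^sup>2 * real (W (p - 1)) < real p - 1"
  shows "\<exists>a. lehmer_primroot p a"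
proof (rule ccontr)
  assume none: "\<not> ?thesis"
  define m where "m = p - 1"
  define L where "L = prime_factors m"
  define E where "E = 2 * sqrt (real p) * (T p)\<^sup>2 * (ln (real p))\<^sup>2"
  have m: "m > 1" and p1: "p > 1"
    using p by (auto simp: m_def)
  obtain g where g: "residue_primroot p g"
    using prime_primitive_root_exists[OF _ p(1)] p1 by auto
  define Y where "Y i = g ^ i mod p" for i
  have bij: "bij_betw Y {..<m} {1..<p}"
  proof -
    have "bij_betw Y {..<m} {0<..<p}"
      using residue_primroot_is_generator[OF p1 g] p by (simp add: totient_prime totatives_prime m_def Y_def[abs_def])
    also have "{0<..<p} = {1..<p}"
      by auto
    finally show ?thesis .
  qed
  define f where "f i = inverse_sign p (Y i)" for i
  have charsum: "norm (\<Sum>i<m. expi m (h * i) * f i) \<le> E" for h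
  proof -
    obtain \<eta> where \<eta>: "mod_character p \<eta>" "\<And>i. \<eta> (Y i) = expi m (h * i)"
      using power_characters[OF p(1) g, of h] unfolding Y_def m_def by blast
    have "(\<Sum>i<m. expi m (h * i) * f i) = (\<Sum>x = 1..<p. \<eta> x * inverse_sign p x)"
      using sum.reindex_bij_betw[OF bij, of "\<lambda>x. \<eta> x * inverse_sign p x"] by (simp add: \<eta>(2) f_def)
    then show ?thesis
      using sign_character_sum_bound[OF p(1) _ \<eta>(1)] p(2) by (simp add: E_def)
  qed
  define P where "P i = (\<Prod>l\<in>L. if l dvd i then 0 else 1 :: complex)" for i
  have P: "P i = (if coprime i m then 1 else 0)" for i
  proof -
    have "coprime i m \<longleftrightarrow> (\<forall>l\<in>L. \<not> l dvd i)"
    proof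
      assume cop: "coprime i m"
      show "\<forall>l\<in>L. \<not> l dvd i"
      proof
        fix l assume "l \<in> L"
        then have "prime l" "l dvd m"
          by (auto simp: L_def)
        then show "\<not> l dvd i"
          using coprime_common_divisor[OF cop, of l] not_prime_unit by blast
      qed
    next
      assume nd: "\<forall>l\<in>L. \<not> l dvd i"
      show "coprime i m"
      proof (rule ccontr)
        assume "\<not> coprime i m"
        then have "gcd i m \<noteq> 1"
          using coprime_iff_gcd_eq_1[of i m] by blast
        then obtain l where "prime l" "l dvd gcd i m"
          using prime_factor_nat by blast
        then show False
          using nd m by (auto simp: L_def in_prime_factors_iff)
      qed
    qed
    then show ?thesis
      by (auto simp: P_def L_def prod_zero_iff)
  qed
  have even: "P i * f i = P i" if "i < m" for i
  proof (cases "coprime i m")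
    case True
    then have "i \<in> totatives (totient p)"
      using that m p by (auto simp: totatives_def totient_prime m_def intro!: Nat.gr0I)
    then have "residue_primroot p (Y i)"
      using bij_betwE[OF residue_primroot_bij_betw_primroots[OF p1 g]] unfolding Y_def by blast
    moreover have Y: "Y i \<in> {1..<p}"
      using bij that by (auto simp: bij_betw_def)
    ultimately have "even (Y i + modinv p (Y i))"
      using none lehmer_number_modinv[OF p(1) Y] by (auto simp: lehmer_primroot_def)
    then show ?thesis
      by (simp add: f_def inverse_sign_def)
  qed (simp add: P)
  have "(\<Sum>i<m. P i) = of_nat (totient m)"
  proof -
    have "(\<Sum>i<m. P i) = of_nat (card {i \<in> {..<m}. coprime i m})"
      by (simp add: P sum.If_cases Int_def)
    also have "{i \<in> {..<m}. coprime i m} = totatives m"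
      using m by (auto simp: totatives_def intro!: Nat.gr0I le_neq_implies_less)
    finally show ?thesis
      by (simp add: totient_def)
  qed
  moreover have "(\<Sum>i<m. expi m (0 * i) * P i * f i) = (\<Sum>i<m. P i)"
    using even by (intro sum.cong refl) (simp add: expi_def)
  ultimately have "real (totient m) = norm (\<Sum>i<m. expi m (0 * i) * P i * f i)"
    by (simp only: norm_of_nat)
  also have "\<dots> \<le> (\<Prod>l\<in>L. 2 * (1 - 1 / real l)) * E"
    unfolding P_def using m charsum
    by (intro character_sieve) (auto simp: L_def in_prime_factors_iff prime_gt_0_nat)
  also have "(\<Prod>l\<in>L. 2 * (1 - 1 / real l)) = real (W m) * (real (totient m) / real m)"
    using m unfolding prod.distrib prod_constant
    by (simp add: W_def num_prime_divisors_def L_def totient_formula2)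
  finally have "real (totient m) * real m \<le> real (totient m) * (E * real (W m))"
    using m by (simp add: field_simps)
  then have "real m \<le> E * real (W m)"
    using m by (simp add: mult_le_cancel_left_pos)
  with bound p show False
    by (simp add: E_def m_def of_nat_diff)
qed

section \<open>The size of the tangent sum\<close>

text \<open>
  The Taylor polynomial of degree 3 shows \<open>sin (31 / 60) < 1 / 2 = sin (pi / 6)\<close>.
\<close>

lemma pi_gt_31_tenths: "pi > 31 / 10"
proof (rule ccontr)
  assume "\<not> ?thesis"
  then have "sin (pi / 6) \<le> sin (31 / 60)"
    using pi_ge_two by (intro sin_monotone_2pi_le) auto
  moreover have "\<bar>sin (31 / 60 :: real) - (\<Sum>m<5. sin_coeff m * (31 / 60) ^ m)\<bar> \<le> inverse (fact 5) * \<bar>31 / 60\<bar> ^ 5"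
    by (rule Maclaurin_sin_bound)
  then have "\<bar>sin (31 / 60 :: real) - 639809 / 1296000\<bar> \<le> 1 / 3000"
    by (simp add: sin_coeff_Suc cos_coeff_Suc eval_nat_numeral)
  then have "sin (31 / 60 :: real) < 1 / 2"
    by linarith
  ultimately show False
    by (simp add: sin_30)
qed

text \<open>
  The derivative of \<open>(1 - x^2 / 3) sin x - x cos x\<close> is \<open>x / 3 (sin x - x cos x)\<close>, and that of
  \<open>sin x - x cos x\<close> is \<open>x sin x\<close>. Both functions vanish at 0.
\<close>

lemma cot_le:
  assumes "0 < x" "x < pi / 2"
  shows "cot x \<le> 1 / x - x / 3"
proof -
  have key: "x * cos x \<le> sin x" if "0 \<le> x" "x \<le> pi / 2" for x :: real
  proof -
    have "(\<lambda>x. sin x - x * cos x) 0 \<le> (\<lambda>x. sin x - x * cos x) x"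
    proof (rule DERIV_nonneg_imp_nondecreasing[OF that(1)])
      fix u :: real assume u: "0 \<le> u" "u \<le> x"
      have "((\<lambda>x. sin x - x * cos x) has_real_derivative u * sin u) (at u)"
        by (auto intro!: derivative_eq_intros)
      moreover have "u * sin u \<ge> 0"
        using u that by (intro mult_nonneg_nonneg sin_ge_zero) auto
      ultimately show "\<exists>y. ((\<lambda>x. sin x - x * cos x) has_real_derivative y) (at u) \<and> 0 \<le> y"
        by blast
    qed
    then show ?thesis by simp
  qed
  let ?h = "\<lambda>x :: real. (1 - x ^ 2 / 3) * sin x - x * cos x"
  have "?h 0 \<le> ?h x"
  proof (rule DERIV_nonneg_imp_nondecreasing[of 0 x ?h])
    fix u :: real assume u: "0 \<le> u" "u \<le> x"
    have "(?h has_real_derivative u / 3 * (sin u - u * cos u)) (at u)"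
      by (auto intro!: derivative_eq_intros simp: field_simps power2_eq_square)
    moreover have "u / 3 * (sin u - u * cos u) \<ge> 0"
      using u assms key[of u] by (intro mult_nonneg_nonneg) auto
    ultimately show "\<exists>y. (?h has_real_derivative y) (at u) \<and> 0 \<le> y"
      by blast
  qed (use assms in auto)
  moreover have "sin x > 0"
    using assms by (intro sin_gt_zero) auto
  ultimately show ?thesis
    using assms by (simp add: cot_def field_simps power2_eq_square)
qed

lemma sum_inverse_odd_le:
  assumes "h > 0"
  shows "(\<Sum>i<h. 1 / real (2 * i + 1)) \<le> 1 + ln (real h) / 2"
  using assms
proof (induction h rule: nat_induct_non_zero)
  case (Suc h)
  have "1 / real (2 * h + 1) \<le> (ln (real (Suc h)) - ln (real h)) / 2"
    using ln_inverse_approx_ge[of "real h" "real (Suc h)"] Suc.hyps by (simp add: add_ac)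
  then show ?case
    using Suc.IH by (simp add: add_divide_distrib diff_divide_distrib)
qed simp

text \<open>
  Reversing the order of summation, the tangents become cotangents of the odd multiples of \<open>\<pi> / (2 m)\<close>. The
  main term \<open>1 / x\<close> of \<open>cot_le\<close> gives a harmonic sum, and \<open>T m\<close> tends to \<open>2 / \<pi>\<close>, which is less than
  \<open>1 / sqrt 2\<close>. The correction \<open>- x / 3\<close> is what makes the bound effective already for \<open>ln m \<ge> 10\<close>.
\<close>

lemma T_squared_le:
  assumes m: "odd m" and ln_m: "ln (real m) \<ge> 10"
  shows "2 * (T m)\<^sup>2 \<le> 1"
proof -
  define h where "h = (m - 1) div 2"
  define c where "c = ln (real m)"
  have m0: "m > 0"
    using m by (rule odd_pos)
  have mh: "m = 2 * h + 1"
    using m by (auto simp: h_def elim: oddE)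
  have "real m = exp c"
    using m0 by (simp add: c_def)
  then have "real m \<ge> 1 + c"
    using exp_ge_add_one_self by simp
  with mh ln_m have h5: "h \<ge> 5"
    by (simp add: c_def)
  have big: "real m > 400"
  proof -
    have "exp (10 :: real) = exp 1 ^ 10"
      by (simp flip: exp_of_nat_mult)
    moreover have "(2 :: real) ^ 10 \<le> exp 1 ^ 10"
      using exp_ge_add_one_self[of 1] by (intro power_mono) auto
    moreover have "exp 10 \<le> real m"
      using ln_m m0 by (simp add: ln_ge_iff)
    ultimately show ?thesis by simp
  qed
  define \<alpha> where "\<alpha> i = pi * real (2 * i + 1) / (2 * real m)" for i :: nat
  have "(\<Sum>j = 1..h. tan (pi * real j / real m)) = (\<Sum>i<h. cot (\<alpha> i))"
  proof (rule sum.reindex_bij_witness[of _ "\<lambda>i. h - i" "\<lambda>j. h - j"])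
    fix j assume j: "j \<in> {1..h}"
    then have "\<alpha> (h - j) = pi / 2 - pi * real j / real m"
      using m0 by (simp add: \<alpha>_def mh of_nat_diff field_simps)
    then show "cot (\<alpha> (h - j)) = tan (pi * real j / real m)"
      by (simp add: cot_def tan_def sin_diff cos_diff)
  qed auto
  also have "\<dots> \<le> (\<Sum>i<h. 1 / \<alpha> i - \<alpha> i / 3)"
  proof (intro sum_mono cot_le)
    fix i assume "i \<in> {..<h}"
    then have "real (2 * i + 1) / real m < 1"
      using m0 by (simp add: mh)
    from mult_strict_left_mono[OF this, of "pi / 2"] show "0 < \<alpha> i" "\<alpha> i < pi / 2"
      using m0 by (simp_all add: \<alpha>_def)
  qed
  also have "\<dots> = 2 * real m / pi * (\<Sum>i<h. 1 / real (2 * i + 1)) - pi / (6 * real m) * (\<Sum>i<h. real (2 * i + 1))"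
    by (simp add: \<alpha>_def sum_subtractf sum_distrib_left field_simps)
  also have "(\<Sum>i<h. real (2 * i + 1)) = real h ^ 2"
    by (induction h) (simp_all add: power2_eq_square algebra_simps)
  also have "(\<Sum>i<h. 1 / real (2 * i + 1)) \<le> 1 + (c - 2 / 3) / 2"
  proof -
    have "ln (real h) \<le> ln (real m / 2)"
      using h5 by (simp add: mh)
    also have "\<dots> \<le> c - 2 / 3"
      using m0 ln2_ge_two_thirds by (simp add: ln_div c_def)
    finally have "ln (real h) / 2 \<le> (c - 2 / 3) / 2"
      by simp
    moreover have "(\<Sum>i<h. 1 / real (2 * i + 1)) \<le> 1 + ln (real h) / 2"
      using h5 by (intro sum_inverse_odd_le) simp
    ultimately show ?thesis
      by linarith
  qed
  finally have sum: "(\<Sum>j = 1..h. tan (pi * real j / real m))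
      \<le> 2 * real m / pi * (1 + (c - 2 / 3) / 2) - pi / (6 * real m) * real h ^ 2"
    using m0 by (simp add: mult_left_mono divide_right_mono)
  have h2: "real h ^ 2 \<ge> 24 / 100 * real m ^ 2"
  proof -
    have "real h \<ge> 49 / 100 * real m"
      using big by (simp add: mh)
    then have "(49 / 100 * real m) ^ 2 \<le> real h ^ 2"
      using m0 by (intro power_mono) auto
    moreover have "(24 / 100 :: real) * real m ^ 2 \<le> (49 / 100 * real m) ^ 2"
      by (simp add: power_mult_distrib power2_eq_square)
    ultimately show ?thesis
      by linarith
  qed
  have "T m = 2 / (real m * c) * (\<Sum>j = 1..h. tan (pi * real j / real m))"
    by (simp add: T_def h_def c_def)
  also have "\<dots> \<le> 2 / (real m * c) * (2 * real m / pi * (1 + (c - 2 / 3) / 2) - pi / (6 * real m) * real h ^ 2)"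
    using sum m0 ln_m by (intro mult_left_mono) (auto simp: c_def)
  also have "\<dots> \<le> 2 / (real m * c) * (2 * real m / (31 / 10) * (1 + (c - 2 / 3) / 2) - (31 / 10) / (6 * real m) * (24 / 100 * real m ^ 2))"
    using m0 ln_m pi_gt_31_tenths h2
    by (intro mult_left_mono diff_mono mult_mono divide_left_mono divide_right_mono) (auto simp: c_def)
  also have "\<dots> \<le> 7071 / 10000"
  proof -
    have c: "c \<ge> 10" "c > 0"
      using ln_m by (simp_all add: c_def)
    have "real m * 10 \<le> real m * c"
      using c by (intro mult_left_mono) auto
    then show ?thesis
      using m0 c by (simp add: field_simps power2_eq_square)
  qed
  finally have upper: "T m \<le> 7071 / 10000" .
  have "T m \<ge> 0"
  proof -
    have "tan (pi * real j / real m) \<ge> 0" if "j \<in> {1..h}" for j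
    proof -
      have j: "real j / real m < 1 / 2" "real j > 0"
        using that by (auto simp: mh field_simps)
      show ?thesis
        using mult_strict_left_mono[OF j(1) pi_gt_zero] j(2) m0 by (intro less_imp_le tan_gt_zero) auto
    qed
    then show ?thesis
      using ln_m by (auto simp: T_def h_def intro!: divide_nonneg_nonneg mult_nonneg_nonneg sum_nonneg)
  qed
  then have "(T m)\<^sup>2 \<le> (7071 / 10000)\<^sup>2"
    using upper by (intro power_mono)
  then show ?thesis
    by (simp add: power2_eq_square)
qed

text \<open>
  In terms of \<open>c = ln x\<close> a stronger form of the claim is \<open>exp (c / 4) \<le> 7 / 5 * c\<close>. The left-hand side
  is convex, so it is enough to compare it with the right-hand side at the endpoints \<open>c = 2\<close> and \<open>c = 10\<close>.
\<close>

lemma sqrt_le_two_ln_squared: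
  fixes x :: real
  assumes "x \<ge> 8" "ln x < 10"
  shows "sqrt x \<le> 2 * (ln x)\<^sup>2"
proof -
  define c where "c = ln x"
  have x: "x > 0"
    using assms by simp
  have "2 \<le> c"
  proof -
    have "3 * ln 2 = ln (8 :: real)"
      using ln_realpow[of 2 3] by simp
    also have "\<dots> \<le> c"
      using assms by (simp add: c_def)
    finally show ?thesis
      using ln2_ge_two_thirds by simp
  qed
  have e: "exp (1 / 8 :: real) \<le> 73 / 64"
    using exp_bound[of "1 / 8"] by (simp add: power2_eq_square)
  have "exp (c / 4) \<le> 7 / 5 * c"
  proof -
    define t where "t = (c - 2) / 8"
    have t: "0 \<le> t" "t \<le> 1"
      using \<open>2 \<le> c\<close> assms by (auto simp: t_def c_def)
    have conv: "convex_on UNIV (exp :: real \<Rightarrow> real)"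
      by (rule exp_convex)
    have "exp ((1 - t) * (1 / 2) + t * (5 / 2)) \<le> (1 - t) * exp (1 / 2) + t * exp (5 / 2 :: real)"
      using convex_onD[OF conv t, of "1 / 2" "5 / 2"] by simp
    also have "\<dots> \<le> (1 - t) * 2 + t * 14"
    proof (intro add_mono mult_left_mono)
      have "exp (5 / 2 :: real) = exp (1 / 8) ^ 20"
        by (simp flip: exp_of_nat_mult)
      also have "\<dots> \<le> (73 / 64) ^ 20"
        using e by (intro power_mono) auto
      finally show "exp (5 / 2 :: real) \<le> 14"
        by (rule order_trans) (simp add: power_divide)
    qed (use t exp_half_le2 in auto)
    also have "\<dots> \<le> 7 / 5 * c"
      using t \<open>2 \<le> c\<close> by (simp add: t_def field_simps)
    finally show ?thesis
      by (simp add: t_def field_simps)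
  qed
  then have "exp (c / 4) ^ 2 \<le> (7 / 5 * c) ^ 2"
    by (intro power_mono) auto
  also have "exp (c / 4) ^ 2 = sqrt x"
  proof -
    have "(exp (c / 4) ^ 2) ^ 2 = exp c"
      by (simp flip: exp_of_nat_mult)
    also have "\<dots> = x"
      using x by (simp add: c_def)
    finally show ?thesis
      by (metis real_sqrt_unique zero_le_power2)
  qed
  also have "(7 / 5 * c) ^ 2 \<le> 2 * c ^ 2"
    by (simp add: power_mult_distrib power2_eq_square)
  finally show ?thesis
    by (simp add: c_def)
qed

section \<open>Existence of Lehmer primitive roots\<close>

theorem corollary1:
  fixes p :: nat
  assumes "prime p" and "p > 3"
  shows "(real p powr (1 / 2) >
            2 * (T p)\<^sup>2 * real (W (p - 1)) * (ln (real p))\<^sup>2 + real p powr (- 1 / 2)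
          \<longrightarrow> (\<exists>a. lehmer_primroot p a)) \<and>
         (p > 7 \<longrightarrow>
          real p powr (1 / 2) > real (W (p - 1)) * (ln (real p))\<^sup>2 + real p powr (- 1 / 2)
          \<longrightarrow> (\<exists>a. lehmer_primroot p a))"
proof (intro conjI impI)
  have p0: "real p > 0"
    using assms by simp
  have half: "real p powr (1 / 2) = sqrt (real p)"
    using p0 by (simp add: powr_half_sqrt)
  have minus_half: "real p powr (- 1 / 2) = 1 / sqrt (real p)"
    using p0 powr_minus_divide[of "real p" "1 / 2"] by (simp add: powr_half_sqrt)
  show first: "\<exists>a. lehmer_primroot p a" if "real p powr (1 / 2) >
      2 * (T p)\<^sup>2 * real (W (p - 1)) * (ln (real p))\<^sup>2 + real p powr (- 1 / 2)"
  proof (rule lehmer_primroot_exists[OF assms])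
    have "sqrt (real p) * (2 * (T p)\<^sup>2 * real (W (p - 1)) * (ln (real p))\<^sup>2 + 1 / sqrt (real p))
        < sqrt (real p) * sqrt (real p)"
      using that p0 unfolding half minus_half by (intro mult_strict_left_mono) auto
    then show "2 * sqrt (real p) * (T p)\<^sup>2 * (ln (real p))\<^sup>2 * real (W (p - 1)) < real p - 1"
      using p0 by (simp add: algebra_simps)
  qed
  assume p7: "p > 7" and hyp: "real p powr (1 / 2) > real (W (p - 1)) * (ln (real p))\<^sup>2 + real p powr (- 1 / 2)"
  have odd: "odd p"
    using assms prime_odd_nat by auto
  have "2 \<in> prime_factors (p - 1)"
    using odd assms by (auto simp: in_prime_factors_iff)
  then have "card (prime_factors (p - 1)) \<ge> 1"
    by (metis One_nat_def Suc_leI card_gt_0_iff empty_iff finite_set_mset)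
  then have W2: "W (p - 1) \<ge> 2"
    using power_increasing[of 1 _ "2 :: nat"] by (simp add: W_def num_prime_divisors_def)
  have "ln (real p) \<ge> 10"
  proof (rule ccontr)
    assume "\<not> ?thesis"
    then have "sqrt (real p) \<le> 2 * (ln (real p))\<^sup>2"
      using p7 by (intro sqrt_le_two_ln_squared) auto
    also have "\<dots> \<le> real (W (p - 1)) * (ln (real p))\<^sup>2"
      using W2 by (intro mult_right_mono) auto
    also have "\<dots> < sqrt (real p)"
    proof -
      have "real p powr (- 1 / 2) \<ge> 0"
        by simp
      with hyp show ?thesis
        unfolding half by linarith
    qed
    finally show False by simp
  qed
  then have "2 * (T p)\<^sup>2 \<le> 1"
    by (rule T_squared_le[OF odd])
  then have "2 * (T p)\<^sup>2 * (real (W (p - 1)) * (ln (real p))\<^sup>2) \<le> 1 * (real (W (p - 1)) * (ln (real p))\<^sup>2)"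
    by (intro mult_right_mono) auto
  then show "\<exists>a. lehmer_primroot p a"
    using hyp by (intro first) (simp add: mult.assoc)
qed

end
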